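(* Let $M$ be a monotone (in particular ptolemaic) Möbius structure on the circle $X=S^1$ that satisfies the Increment Axiom (I). Then every line $h\subset\mathrm{Harm}$ is a geodesic with respect to the $\delta$-distance, i.e. $\delta(q,q')=|qq'|$ for any $q,q'\in h$.
   Context: Möbius structures. A semi-metric on a set $X$ is a symmetric function $d:X^2\to\mathbb R\cup\{\infty\}$, zero on the diagonal and positive off it, having at most one infinitely remote point, i.e. a point $\omega\in X$ with $d(x,\omega)=\infty$ for some $x\ne\omega$; if $\omega$ is such a point, then $d(x,\omega)=\infty$ for all $x\neq\omega$. We write $|xy|=d(x,y)$. In ratios, equations and inequalities between products of distances in which each side has an infinite factor, the infinite factors cancel. A 4-tuple is nondegenerate if its entries are pairwise distinct; $\mathrm{reg}\,\mathcal P_n$ is the set of ordered nondegenerate $n$-tuples of $X$. For $q=(x_1,x_2,x_3,x_4)\in\mathrm{reg}\,\mathcal P_4$ put $$\mathrm{cr}_1(q)=\frac{|x_1x_3||x_2x_4|}{|x_1x_4||x_2x_3|},\quad \mathrm{cr}_2(q)=\frac{|x_1x_4||x_2x_3|}{|x_1x_2||x_3x_4|},\quad \mathrm{cr}_3(q)=\frac{|x_1x_2||x_3x_4|}{|x_2x_4||x_1x_3|}.$$ Two semi-metrics are Möbius equivalent if they have the same cross-ratios on every $q\in\mathrm{reg}\,\mathcal P_4$; a Möbius structure $M$ on $X$ is a class of Möbius equivalent semi-metrics. For each $\omega\in X$ there is a semi-metric in $M$ with infinitely remote point $\omega$, unique up to homothety (obtained by the metric inversion $d_\omega(x,y)=d(x,y)/(d(x,\omega)d(y,\omega))$).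 $M$ is ptolemaic if $|xy||zu|\le|xz||yu|+|xu||yz|$ for every semi-metric of $M$ and every 4-tuple $(x,y,z,u)$. The $M$-topology on $X$ has as subbase all open balls centered at finite points of all semi-metrics from $M$ having infinitely remote points. Axioms. A Möbius structure $M$ on $X=S^1$ is monotone if it is ptolemaic and: (T) the $M$-topology is the standard topology of $S^1$; (M) for each 4-tuple $(x,y,z,u)\in X^4$ such that the pairs $(x,y)$, $(z,u)$ separate each other, $|xy||zu|>\max\{|xz||yu|,|xu||yz|\}$ for some (hence any) semi-metric from $M$. A 4-tuple $(x,y,z,u)\in\mathrm{reg}\,\mathcal P_4$ is harmonic if at least one of $\mathrm{cr}_1,\mathrm{cr}_2,\mathrm{cr}_3$ equals $1$ on it. Increment Axiom (I): for any $(x_1,\dots,x_7)\in\mathrm{reg}\,\mathcal P_7$ whose points occur on the circle in the cyclic order $1234567$ and such that the 4-tuples $(x_1,x_3,x_5,x_6)$ and $(x_2,x_3,x_4,x_6)$ are harmonic, one has $\mathrm{cr}_1(x_1,x_2,x_6,x_7)>\mathrm{cr}_1(x_4,x_5,x_6,x_7)$. Harmonic pairs and lines. Let $\mathrm{aY}$ be the set of unordered pairs $(x,y)\sim(y,x)$ of distinct points of $X$. A pair $(a,b)\in\mathrm{aY}\times\mathrm{aY}$, $a=(x,y)$, $b=(z,u)$, $x,y,z,u$ pairwise distinct, is harmonic if $|xz||yu|=|xu||yz|$ for some (hence any) semi-metric from $M$. $\mathrm{Harm}\subset\mathrm{aY}\times\mathrm{aY}$ is the set of harmonic pairs $(a,b)$;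 $a$ is the left axis and $b$ the right axis of $(a,b)$. A left line is a set of all elements of $\mathrm{Harm}$ with a given left axis; a right line is a set of all elements of $\mathrm{Harm}$ with a given right axis; a line is a left or a right line. For $q=(a,b)$, $q'=(a,b')$ in a left line, with $a=(x,y)$, $b=(z,u)$, $b'=(z',u')$, put $$|qq'|=\left|\ln\frac{|xz'||yz|}{|xz||yz'|}\right|$$ for any semi-metric from $M$ (the value does not depend on the choices); for $q=(b,a)$, $q'=(b',a)$ in a right line, $|qq'|$ is defined by the same formula. Zig-zag paths and $\delta$. A pair $d\in\mathrm{aY}$ separates $b,c\in\mathrm{aY}$ if $b$ and $c$ lie on different open arcs of $X$ determined by $d$. For distinct $q=(a,b)$, $q'=(a,b')$ in a left line, the (left) segment $qq'$ consists of its ends $q,q'$ and all $(a,b'')\in\mathrm{Harm}$ such that $b''$ separates $b,b'$; right segments are defined similarly on right lines. A zig-zag path (zz-path) from $q$ to $q'$ is a finite, maybe empty, alternating sequence of left and right segments (sides) $q_0q_1,q_1q_2,\dots,q_{k-1}q_k$ with $q_0=q$, $q_k=q'$ (the empty path connects $q$ with itself). The length $|S|$ of a zz-path $S$ is the sum of the lengths $|q_{i-1}q_i|$ of its sides, and $\delta(q,q')=\inf_S|S|$ over all zz-paths $S$ from $q$ to $q'$. *)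

theory Defs
  imports "HOL-Analysis.Analysis"
begin

section \<open>Semi-metrics and Moebius structures\<close>

type_synonym 'a semimetric = "'a \<Rightarrow> 'a \<Rightarrow> ereal"

definition infinitely_remote :: "'a set \<Rightarrow> 'a semimetric \<Rightarrow> 'a \<Rightarrow> bool" where
  "infinitely_remote X d \<omega> \<longleftrightarrow> \<omega> \<in> X \<and> (\<forall>x\<in>X - {\<omega>}. d x \<omega> = \<infinity>)"

text \<open>An infinite distance can only come from an infinitely remote point. (Calling every
  \<open>\<omega>\<close> with \<open>d x \<omega> = \<infinity>\<close> for some \<open>x \<noteq> \<omega>\<close> infinitely remote would, by symmetry of \<open>d\<close>, make
  \<open>x\<close> infinitely remote as well.)\<close>

definition is_semimetric :: "'a set \<Rightarrow> 'a semimetric \<Rightarrow> bool" where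
  "is_semimetric X d \<longleftrightarrow>
     (\<forall>x\<in>X. d x x = 0) \<and>
     (\<forall>x\<in>X. \<forall>y\<in>X. d x y = d y x) \<and>
     (\<forall>x\<in>X. \<forall>y\<in>X. x \<noteq> y \<longrightarrow> d x y > 0) \<and>
     (\<forall>x\<in>X. \<forall>y\<in>X. d x y = \<infinity> \<longrightarrow> infinitely_remote X d x \<or> infinitely_remote X d y) \<and>
     (\<forall>\<omega> \<omega>'. infinitely_remote X d \<omega> \<and> infinitely_remote X d \<omega>' \<longrightarrow> \<omega> = \<omega>')"

text \<open>The factor \<open>|xy|\<close> as it enters products of distances. In all ratios, equations and
  inequalities below the infinite factors occur equally often in each product on either side
  (degenerate instances of the Ptolemy inequality are trivially true), so cancelling them
  amounts to replacing each of them by \<open>1\<close>.\<close>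

definition factor :: "'a semimetric \<Rightarrow> 'a \<Rightarrow> 'a \<Rightarrow> real" where
  "factor d x y = (if d x y = \<infinity> then 1 else real_of_ereal (d x y))"

definition cr1 :: "'a semimetric \<Rightarrow> 'a \<Rightarrow> 'a \<Rightarrow> 'a \<Rightarrow> 'a \<Rightarrow> real" where
  "cr1 d x1 x2 x3 x4 =
     (factor d x1 x3 * factor d x2 x4) / (factor d x1 x4 * factor d x2 x3)"

definition cr2 :: "'a semimetric \<Rightarrow> 'a \<Rightarrow> 'a \<Rightarrow> 'a \<Rightarrow> 'a \<Rightarrow> real" where
  "cr2 d x1 x2 x3 x4 =
     (factor d x1 x4 * factor d x2 x3) / (factor d x1 x2 * factor d x3 x4)"

definition cr3 :: "'a semimetric \<Rightarrow> 'a \<Rightarrow> 'a \<Rightarrow> 'a \<Rightarrow> 'a \<Rightarrow> real" where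
  "cr3 d x1 x2 x3 x4 =
     (factor d x1 x2 * factor d x3 x4) / (factor d x2 x4 * factor d x1 x3)"

definition moebius_equivalence :: "'a set \<Rightarrow> ('a semimetric \<times> 'a semimetric) set" where
  "moebius_equivalence X =
     {(d, d'). is_semimetric X d \<and> is_semimetric X d' \<and>
        (\<forall>x1\<in>X. \<forall>x2\<in>X. \<forall>x3\<in>X. \<forall>x4\<in>X. distinct [x1, x2, x3, x4] \<longrightarrow>
           cr1 d x1 x2 x3 x4 = cr1 d' x1 x2 x3 x4 \<and>
           cr2 d x1 x2 x3 x4 = cr2 d' x1 x2 x3 x4 \<and>
           cr3 d x1 x2 x3 x4 = cr3 d' x1 x2 x3 x4)}"

definition moebius_structure :: "'a set \<Rightarrow> 'a semimetric set \<Rightarrow> bool" where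
  "moebius_structure X M \<longleftrightarrow> M \<in> {d. is_semimetric X d} // moebius_equivalence X"

definition ptolemaic :: "'a set \<Rightarrow> 'a semimetric set \<Rightarrow> bool" where
  "ptolemaic X M \<longleftrightarrow>
     (\<forall>d\<in>M. \<forall>x\<in>X. \<forall>y\<in>X. \<forall>z\<in>X. \<forall>u\<in>X.
        factor d x y * factor d z u \<le> factor d x z * factor d y u + factor d x u * factor d y z)"

definition moebius_topology :: "'a set \<Rightarrow> 'a semimetric set \<Rightarrow> 'a topology" where
  "moebius_topology X M =
     topology_generated_by
       {{y\<in>X. d x y < ereal r} | d x r.
          d \<in> M \<and> (\<exists>\<omega>. infinitely_remote X d \<omega>) \<and> x \<in> X \<and> \<not> infinitely_remote X d x \<and> r > 0}"

section \<open>Axioms on the circle\<close>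

abbreviation S1 :: "complex set" where
  "S1 \<equiv> sphere 0 1"

definition open_arc :: "real \<Rightarrow> real \<Rightarrow> complex set" where
  "open_arc s t = cis ` {s<..<t}"

definition points_separated_by :: "complex \<Rightarrow> complex \<Rightarrow> complex \<Rightarrow> complex \<Rightarrow> bool" where
  "points_separated_by x y z u \<longleftrightarrow>
     (\<exists>s t. s < t \<and> t < s + 2 * pi \<and> {x, y} = {cis s, cis t} \<and>
        z \<in> open_arc s t \<and> u \<in> open_arc t (s + 2 * pi))"

definition monotone_moebius :: "complex semimetric set \<Rightarrow> bool" where
  "monotone_moebius M \<longleftrightarrow>
     ptolemaic S1 M \<and>
     moebius_topology S1 M = top_of_set S1 \<and>
     (\<forall>x\<in>S1. \<forall>y\<in>S1. \<forall>z\<in>S1. \<forall>u\<in>S1.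
        points_separated_by x y z u \<and> points_separated_by z u x y \<longrightarrow>
        (\<exists>d\<in>M. factor d x y * factor d z u >
           max (factor d x z * factor d y u) (factor d x u * factor d y z)))"

definition counterclockwise :: "complex list \<Rightarrow> bool" where
  "counterclockwise ps \<longleftrightarrow>
     (\<exists>\<theta>s. ps = map cis \<theta>s \<and> sorted_wrt (<) \<theta>s \<and> last \<theta>s < hd \<theta>s + 2 * pi)"

text \<open>The circle carries no preferred orientation. Points in cyclic order are pairwise distinct
  and lie on \<open>S1\<close>.\<close>

definition in_cyclic_order :: "complex list \<Rightarrow> bool" where
  "in_cyclic_order ps \<longleftrightarrow> counterclockwise ps \<or> counterclockwise (rev ps)"

definition harmonic_tuple ::
    "'a semimetric \<Rightarrow> 'a \<Rightarrow> 'a \<Rightarrow> 'a \<Rightarrow> 'a \<Rightarrow> bool" where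
  "harmonic_tuple d x1 x2 x3 x4 \<longleftrightarrow>
     cr1 d x1 x2 x3 x4 = 1 \<or> cr2 d x1 x2 x3 x4 = 1 \<or> cr3 d x1 x2 x3 x4 = 1"

definition increment_axiom :: "complex semimetric set \<Rightarrow> bool" where
  "increment_axiom M \<longleftrightarrow>
     (\<forall>d\<in>M. \<forall>x1 x2 x3 x4 x5 x6 x7.
        in_cyclic_order [x1, x2, x3, x4, x5, x6, x7] \<and>
        harmonic_tuple d x1 x3 x5 x6 \<and> harmonic_tuple d x2 x3 x4 x6 \<longrightarrow>
        cr1 d x1 x2 x6 x7 > cr1 d x4 x5 x6 x7)"

section \<open>Harmonic pairs and lines\<close>

type_synonym axis_pair = "complex set \<times> complex set"

definition aY :: "complex set set" where
  "aY = {{x, y} | x y. x \<in> S1 \<and> y \<in> S1 \<and> x \<noteq> y}"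

definition Harm :: "complex semimetric set \<Rightarrow> axis_pair set" where
  "Harm M =
     {({x, y}, {z, u}) | x y z u.
        x \<in> S1 \<and> y \<in> S1 \<and> z \<in> S1 \<and> u \<in> S1 \<and> distinct [x, y, z, u] \<and>
        (\<exists>d\<in>M. factor d x z * factor d y u = factor d x u * factor d y z)}"

definition left_line :: "complex semimetric set \<Rightarrow> complex set \<Rightarrow> axis_pair set" where
  "left_line M a = {q \<in> Harm M. fst q = a}"

definition right_line :: "complex semimetric set \<Rightarrow> complex set \<Rightarrow> axis_pair set" where
  "right_line M b = {q \<in> Harm M. snd q = b}"

definition lines :: "complex semimetric set \<Rightarrow> axis_pair set set" where
  "lines M = left_line M ` aY \<union> right_line M ` aY"

text \<open>The distance between two harmonic pairs with the common axis \<open>a\<close> and the other axes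
  \<open>b\<close>, \<open>b'\<close>; its value does not depend on \<open>d\<close> and on the ordering of the three pairs.\<close>

definition axis_dist ::
    "complex semimetric set \<Rightarrow> complex set \<Rightarrow> complex set \<Rightarrow> complex set \<Rightarrow> real" where
  "axis_dist M a b b' =
     (THE r. \<exists>d\<in>M. \<exists>x y z u z' u'. a = {x, y} \<and> b = {z, u} \<and> b' = {z', u'} \<and>
        r = \<bar>ln ((factor d x z' * factor d y z) / (factor d x z * factor d y z'))\<bar>)"

definition line_dist :: "complex semimetric set \<Rightarrow> axis_pair \<Rightarrow> axis_pair \<Rightarrow> real" where
  "line_dist M q q' =
     (if fst q = fst q' then axis_dist M (fst q) (snd q) (snd q')
      else axis_dist M (snd q) (fst q) (fst q'))"

section \<open>Zig-zag paths\<close>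

text \<open>A zz-path with sides \<open>q\<^sub>0q\<^sub>1, \<dots>, q\<^sub>k\<^sub>-\<^sub>1q\<^sub>k\<close> is given by the list of its vertices
  \<open>q\<^sub>0, \<dots>, q\<^sub>k\<close>: any two distinct elements of a left (right) line are the ends of exactly one
  left (right) segment, and the length of a side involves its ends only. The one-element list
  \<open>[q]\<close> is the empty path from \<open>q\<close> to itself.\<close>

definition left_side :: "complex semimetric set \<Rightarrow> axis_pair \<Rightarrow> axis_pair \<Rightarrow> bool" where
  "left_side M q q' \<longleftrightarrow> q \<noteq> q' \<and> (\<exists>a\<in>aY. q \<in> left_line M a \<and> q' \<in> left_line M a)"

definition right_side :: "complex semimetric set \<Rightarrow> axis_pair \<Rightarrow> axis_pair \<Rightarrow> bool" where
  "right_side M q q' \<longleftrightarrow> q \<noteq> q' \<and> (\<exists>b\<in>aY. q \<in> right_line M b \<and> q' \<in> right_line M b)"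

definition zz_path ::
    "complex semimetric set \<Rightarrow> axis_pair \<Rightarrow> axis_pair \<Rightarrow> axis_pair list \<Rightarrow> bool" where
  "zz_path M q q' qs \<longleftrightarrow>
     qs \<noteq> [] \<and> set qs \<subseteq> Harm M \<and> hd qs = q \<and> last qs = q' \<and>
     (\<forall>i. Suc i < length qs \<longrightarrow>
        left_side M (qs ! i) (qs ! Suc i) \<or> right_side M (qs ! i) (qs ! Suc i)) \<and>
     (\<forall>i. Suc (Suc i) < length qs \<longrightarrow>
        (left_side M (qs ! i) (qs ! Suc i) \<longleftrightarrow>
         right_side M (qs ! Suc i) (qs ! Suc (Suc i))))"

definition zz_length :: "complex semimetric set \<Rightarrow> axis_pair list \<Rightarrow> real" where
  "zz_length M qs = (\<Sum>i<length qs - 1. line_dist M (qs ! i) (qs ! Suc i))"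

definition zz_dist :: "complex semimetric set \<Rightarrow> axis_pair \<Rightarrow> axis_pair \<Rightarrow> ereal" where
  "zz_dist M q q' = (INF qs\<in>{qs. zz_path M q q' qs}. ereal (zz_length M qs))"

end

theory Submission imports Defs begin

text \<open>
  Let \<open>a = {x, \<omega>}\<close> be the common axis of two harmonic pairs on a line, and measure distances in a
  semi-metric of \<open>M\<close> with infinitely remote point \<open>\<omega>\<close>. There \<open>|xz| = |xu|\<close> for a pair
  \<open>(a, {z, u})\<close>, and the distance along the line is the difference of the numbers \<open>ln |xz|\<close>. So it is
  enough to extend \<open>ln |xz|\<close> to a function on all harmonic pairs that is 1-Lipschitz along every side:
  telescoping then bounds the length of each zz-path from below, while the single side between the
  two pairs has exactly this length. In the hyperbolic plane a Busemann function centred at \<open>\<omega>\<close>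
  would do; here the extension is the logarithm of a height.

  Let \<open>e'\<close> be the other end of the axis of \<open>e\<close>, and \<open>n\<close> an end of the other axis. The
  number \<open>|ee'| |en| / |e'n|\<close> changes exactly at unit logarithmic rate when the axis \<open>{e, e'}\<close> is
  kept and the other axis moves, and harmonicity makes it independent of \<open>n\<close>. The height is the minimum of these
  numbers over the ends \<open>e \<noteq> \<omega>\<close> of both axes. It is symmetric in the two axes, so that only sides with a
  fixed left axis need to be examined, and it equals \<open>|xz|\<close> on the given line.

  If the fixed axis of a side contains \<open>\<omega>\<close>, the height varies exactly as required. Otherwise view the
  circle without \<open>\<omega>\<close> as a real line on which the fixed axis is \<open>p < q\<close>. The moving axis has one end
  \<open>r\<close> in \<open>(p, q)\<close>, and \<open>ln u\<close> with \<open>u = |pr| / |qr|\<close> is the arc length parameter of the side. When the other end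
  \<open>s\<close> lies beyond \<open>q\<close>, the height is \<open>min C A / u\<close> with \<open>C = |pq|\<close> and \<open>A = |rs| |pr| / |qs|\<close>.
  The Lipschitz bound consists of two monotonicities in \<open>u\<close>:

  \<^item> \<open>min C A / u\<^sup>2\<close> does not increase. This follows from the separation inequalities of Axiom (M).

  \<^item> \<open>min C A\<close> does not decrease. As \<open>r\<close> moves up to \<open>r'\<close>, \<open>s\<close> moves down to \<open>s'\<close>, and the factor \<open>|rs| / |qs|\<close>
  grows by Axiom (M). It remains to see that \<open>g z = |pz| |zs'|\<close> satisfies \<open>g r \<le> g r'\<close> whenever
  \<open>g r' < g q\<close>: this is the case that the value of \<open>A\<close> at \<open>r', s'\<close> is less than \<open>C\<close>, and otherwise \<open>min C A\<close> has
  already reached its bound \<open>C\<close>. What remains is quasi-concavity of \<open>g\<close>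
  (\<open>product_quasi_concave\<close>).

  Quasi-concavity is where the Increment Axiom enters. With \<open>\<omega>\<close> as the sixth point it says that for
  pairs \<open>x, y\<close> on different sides of a centre \<open>z\<close> with \<open>|zx| = |zy|\<close> the product \<open>|ox| |oy|\<close> decreases when the pair
  moves away from \<open>z\<close>, for each \<open>o\<close> outside. Multiplying the instances for \<open>o = p\<close> and \<open>o = s'\<close> gives
  \<open>g x * g y < (g z)\<^sup>2\<close>, so \<open>g\<close> has no interior local minimum.

  The pairs with \<open>s\<close> below \<open>p\<close> are mirror images, and a side along which \<open>s\<close> passes through \<open>\<omega>\<close> is cut
  there (\<open>height_line_lipschitz\<close>). Axiom (T) is used for the continuity of the distance functions, which
  produces the symmetric pairs, the minimum of \<open>g\<close> and the harmonic pair at which such a side is cut.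
\<close>

section \<open>Changing the semi-metric in a Moebius structure\<close>

lemma factor_sym: "is_semimetric X d \<Longrightarrow> x \<in> X \<Longrightarrow> y \<in> X \<Longrightarrow> factor d x y = factor d y x"
  by (auto simp: is_semimetric_def factor_def)

lemma factor_refl: "is_semimetric X d \<Longrightarrow> x \<in> X \<Longrightarrow> factor d x x = 0"
  by (auto simp: is_semimetric_def factor_def)

lemma factor_pos:
  assumes "is_semimetric X d" "x \<in> X" "y \<in> X" "x \<noteq> y"
  shows "0 < factor d x y"
proof -
  have "0 < d x y" using assms by (auto simp: is_semimetric_def)
  then show ?thesis by (cases "d x y") (auto simp: factor_def)
qed

lemma factor_remote: "infinitely_remote X d \<omega> \<Longrightarrow> x \<in> X \<Longrightarrow> x \<noteq> \<omega> \<Longrightarrow> factor d x \<omega> = 1"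
  by (auto simp: infinitely_remote_def factor_def)

lemma moebius_structure_equivalent:
  assumes "moebius_structure X M" "d \<in> M" "d' \<in> M"
  shows "(d, d') \<in> moebius_equivalence X"
proof -
  obtain c where "M = moebius_equivalence X `` {c}"
    using assms(1) by (auto simp: moebius_structure_def quotient_def)
  then have "(c, d) \<in> moebius_equivalence X" "(c, d') \<in> moebius_equivalence X"
    using assms by auto
  then show ?thesis unfolding moebius_equivalence_def by simp
qed

lemma moebius_structure_closed:
  assumes "moebius_structure X M" "d \<in> M" "(d, d') \<in> moebius_equivalence X"
  shows "d' \<in> M"
proof -
  obtain c where c: "M = moebius_equivalence X `` {c}"
    using assms(1) by (auto simp: moebius_structure_def quotient_def)
  then have "(c, d) \<in> moebius_equivalence X" using assms by auto
  then have "(c, d') \<in> moebius_equivalence X"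
    using assms(3) unfolding moebius_equivalence_def by simp
  then show ?thesis using c by simp
qed

lemma moebius_structure_semimetric:
  "moebius_structure X M \<Longrightarrow> d \<in> M \<Longrightarrow> is_semimetric X d"
  using moebius_structure_equivalent[of X M d d] by (auto simp: moebius_equivalence_def)

lemma moebius_structure_nonempty:
  assumes "moebius_structure X M" obtains d where "d \<in> M"
proof -
  obtain c where c: "M = moebius_equivalence X `` {c}" "is_semimetric X c"
    using assms(1) by (auto simp: moebius_structure_def quotient_def)
  then have "c \<in> M" by (auto simp: moebius_equivalence_def)
  then show thesis by (rule that)
qed

text \<open>Infinite factors count as \<open>1\<close>, so the same formula serves when \<open>d\<close> itself has an infinitely remote
  point; if that point is \<open>\<omega>\<close>, the inversion does not change \<open>d\<close> on the distances between points of the space.\<close>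

definition metric_inversion :: "'a semimetric \<Rightarrow> 'a \<Rightarrow> 'a semimetric" where
  "metric_inversion d \<omega> x y =
     (if x = y then 0 else if x = \<omega> \<or> y = \<omega> then \<infinity>
      else ereal (factor d x y / (factor d x \<omega> * factor d y \<omega>)))"

lemma factor_metric_inversion:
  assumes "x \<noteq> y"
  shows "factor (metric_inversion d \<omega>) x y =
    (if x = \<omega> \<or> y = \<omega> then 1 else factor d x y / (factor d x \<omega> * factor d y \<omega>))"
  using assms by (simp add: factor_def metric_inversion_def)

lemma remote_metric_inversion: "\<omega> \<in> X \<Longrightarrow> infinitely_remote X (metric_inversion d \<omega>) \<omega>"
  by (auto simp: infinitely_remote_def metric_inversion_def)

text \<open>Infinitely many points ensure that no second point is infinitely remote: in a two-point space both
  points would be.\<close>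

lemma semimetric_metric_inversion:
  assumes d: "is_semimetric X d" and \<omega>: "\<omega> \<in> X" and inf: "infinite X"
  shows "is_semimetric X (metric_inversion d \<omega>)"
proof -
  let ?e = "metric_inversion d \<omega>"
  have unique: "\<omega>' = \<omega>" if "infinitely_remote X ?e \<omega>'" for \<omega>'
  proof (rule ccontr)
    assume "\<omega>' \<noteq> \<omega>"
    have "infinite (X - {\<omega>, \<omega>'})" using inf by simp
    then obtain x where "x \<in> X - {\<omega>, \<omega>'}" using infinite_imp_nonempty by blast
    moreover have "?e x \<omega>' = \<infinity>"
      using that calculation by (auto simp: infinitely_remote_def)
    ultimately show False
      using \<open>\<omega>' \<noteq> \<omega>\<close> by (auto simp: metric_inversion_def)
  qed
  have pos: "0 < ?e x y" if "x \<in> X" "y \<in> X" "x \<noteq> y" for x y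
    using that \<omega> by (auto simp: metric_inversion_def intro!: divide_pos_pos mult_pos_pos factor_pos[OF d])
  have sym: "?e x y = ?e y x" if "x \<in> X" "y \<in> X" for x y
    using that factor_sym[OF d, of x y] by (simp add: metric_inversion_def mult.commute)
  have infinite_ends: "x = \<omega> \<or> y = \<omega>" if "?e x y = \<infinity>" for x y
    using that by (auto simp: metric_inversion_def split: if_splits)
  show ?thesis
    unfolding is_semimetric_def
  proof (intro conjI ballI allI impI)
    show "?e x x = 0" for x by (simp add: metric_inversion_def)
    show "infinitely_remote X ?e x \<or> infinitely_remote X ?e y" if "?e x y = \<infinity>" for x y
      using infinite_ends[OF that] remote_metric_inversion[OF \<omega>, of d] by blast
    show "\<omega>1 = \<omega>2" if "infinitely_remote X ?e \<omega>1 \<and> infinitely_remote X ?e \<omega>2" for \<omega>1 \<omega>2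
      using that unique by blast
  qed (use pos sym in auto)
qed

lemma equivalent_metric_inversion:
  assumes d: "is_semimetric X d" and \<omega>: "\<omega> \<in> X" and inf: "infinite X"
  shows "(d, metric_inversion d \<omega>) \<in> moebius_equivalence X"
proof -
  let ?e = "metric_inversion d \<omega>"
  have "cr1 d x1 x2 x3 x4 = cr1 ?e x1 x2 x3 x4 \<and> cr2 d x1 x2 x3 x4 = cr2 ?e x1 x2 x3 x4 \<and>
      cr3 d x1 x2 x3 x4 = cr3 ?e x1 x2 x3 x4"
    if x: "x1 \<in> X" "x2 \<in> X" "x3 \<in> X" "x4 \<in> X" "distinct [x1, x2, x3, x4]" for x1 x2 x3 x4
  proof -
    \<comment> \<open>All cross-ratios are invariant because the inversion is a conformal change of the factors; this is
      true for the factors at \<open>\<omega>\<close> as well if the weight of \<open>\<omega>\<close> is \<open>1\<close>.\<close>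
    define w where "w = (\<lambda>x. if x = \<omega> then 1 else 1 / factor d x \<omega>)"
    have nz: "factor d x y \<noteq> 0" if "x \<in> X" "y \<in> X" "x \<noteq> y" for x y
      using factor_pos[OF d, of x y] that by simp
    have w_nz: "w x \<noteq> 0" if "x \<in> X" for x
      using nz[OF that \<omega>] by (simp add: w_def)
    have conformal: "factor ?e x y = factor d x y * (w x * w y)" if "x \<in> X" "y \<in> X" "x \<noteq> y" for x y
      using that nz[of x \<omega>] nz[of y \<omega>] factor_sym[OF d \<omega>, of y] \<omega>
      by (cases "x = \<omega>") (simp_all add: factor_metric_inversion w_def)
    show ?thesis
      using x w_nz[OF x(1)] w_nz[OF x(2)] w_nz[OF x(3)] w_nz[OF x(4)]
      by (simp add: cr1_def cr2_def cr3_def conformal)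
  qed
  then show ?thesis
    using d semimetric_metric_inversion[OF assms] by (simp add: moebius_equivalence_def)
qed

lemma product_less_transfer:
  assumes M: "moebius_structure X M" "d \<in> M" "d' \<in> M"
    and x: "x \<in> X" "y \<in> X" "z \<in> X" "u \<in> X" "distinct [x, y, z, u]"
    and less: "factor d x z * factor d y u < factor d x y * factor d z u"
  shows "factor d' x z * factor d' y u < factor d' x y * factor d' z u"
proof -
  have pos: "0 < factor e v w" if "e \<in> M" "v \<in> X" "w \<in> X" "v \<noteq> w" for e v w
    using factor_pos[OF moebius_structure_semimetric[OF M(1)]] that by blast
  have eq: "cr3 d x y z u = cr3 d' x y z u"
    using moebius_structure_equivalent[OF M] x unfolding moebius_equivalence_def by blast
  have big: "1 < cr3 e x y z u \<longleftrightarrow> factor e x z * factor e y u < factor e x y * factor e z u"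
    if "e \<in> M" for e
    using pos[OF that] x unfolding cr3_def by (subst less_divide_eq_1_pos) (auto simp: mult.commute)
  show ?thesis using less eq big[OF M(2)] big[OF M(3)] by simp
qed

lemma cross_ratio_transfer:
  assumes M: "moebius_structure X M" "d \<in> M" "d' \<in> M"
    and x: "x \<in> X" "y \<in> X" "z \<in> X" "u \<in> X" "distinct [x, y, z, u]"
  shows "cr1 d x y z u = cr1 d' x y z u"
  using moebius_structure_equivalent[OF M] x unfolding moebius_equivalence_def by blast

lemma harmonic_transfer:
  assumes M: "moebius_structure X M" "d \<in> M" "d' \<in> M"
    and x: "x \<in> X" "y \<in> X" "z \<in> X" "u \<in> X" "distinct [x, y, z, u]"
    and eq: "factor d x z * factor d y u = factor d x u * factor d y z"
  shows "factor d' x z * factor d' y u = factor d' x u * factor d' y z"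
proof -
  have pos: "0 < factor e v w" if "e \<in> M" "v \<in> X" "w \<in> X" "v \<noteq> w" for e v w
    using factor_pos[OF moebius_structure_semimetric[OF M(1)]] that by blast
  have "factor e x u \<noteq> 0" "factor e y z \<noteq> 0" if "e \<in> M" for e
    using pos[OF that, of x u] pos[OF that, of y z] x by auto
  then have unit: "cr1 e x y z u = 1 \<longleftrightarrow> factor e x z * factor e y u = factor e x u * factor e y z"
    if "e \<in> M" for e
    using that unfolding cr1_def by (auto simp: divide_eq_eq)
  show ?thesis
    using cross_ratio_transfer[OF assms(1-8)] eq unit[OF M(2)] unit[OF M(3)] by simp
qed

section \<open>Harmonic pairs and the distance along a line\<close>

text \<open>The definition of \<open>Harm\<close> chooses the semi-metric and the labelling of the four ends; harmonicity
  depends on neither.\<close>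

lemma Harm_labelled:
  assumes M: "moebius_structure S1 M" "d \<in> M" and q: "({x, y}, {z, u}) \<in> Harm M"
  shows "x \<in> S1 \<and> y \<in> S1 \<and> z \<in> S1 \<and> u \<in> S1" "distinct [x, y, z, u]"
    "factor d x z * factor d y u = factor d x u * factor d y z"
proof -
  obtain x' y' z' u' d' where *: "{x, y} = {x', y'}" "{z, u} = {z', u'}"
     "x' \<in> S1" "y' \<in> S1" "z' \<in> S1" "u' \<in> S1" "distinct [x', y', z', u']" "d' \<in> M"
     "factor d' x' z' * factor d' y' u' = factor d' x' u' * factor d' y' z'"
    using q unfolding Harm_def by blast
  have h: "factor d x' z' * factor d y' u' = factor d x' u' * factor d y' z'"
    using harmonic_transfer[OF M(1) *(8) M(2) *(3-7,9)] .
  show "x \<in> S1 \<and> y \<in> S1 \<and> z \<in> S1 \<and> u \<in> S1" "distinct [x, y, z, u]"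
    "factor d x z * factor d y u = factor d x u * factor d y z"
    using *(1-7) h by (auto simp: doubleton_eq_iff mult.commute)
qed

lemma Harm_cases:
  assumes "q \<in> Harm M"
  obtains x y z u where "q = ({x, y}, {z, u})"
  using assms unfolding Harm_def by blast

lemma Harm_swap:
  assumes M: "moebius_structure S1 M" and q: "(a, b) \<in> Harm M"
  shows "(b, a) \<in> Harm M"
proof -
  obtain x y z u where xy: "a = {x, y}" "b = {z, u}"
    using Harm_cases[OF q] by (metis prod.inject)
  obtain d where d: "d \<in> M" using moebius_structure_nonempty[OF M] .
  note h = Harm_labelled[OF M d q[unfolded xy]]
  note sym = factor_sym[OF moebius_structure_semimetric[OF M d]]
  have "factor d z x * factor d u y = factor d z y * factor d u x"
    using h by (simp add: sym[of z] sym[of u] mult.commute)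
  then show ?thesis unfolding xy Harm_def using h d by fastforce
qed

lemma Harm_axis:
  assumes M: "moebius_structure S1 M" and H: "({x, y}, b) \<in> Harm M"
  shows "x \<in> S1" "y \<in> S1" "x \<noteq> y"
proof -
  obtain d where d: "d \<in> M" using moebius_structure_nonempty[OF M] .
  obtain z u where b: "b = {z, u}" using Harm_cases[OF H] by (metis prod.inject)
  show "x \<in> S1" "y \<in> S1" "x \<noteq> y" using Harm_labelled[OF M d H[unfolded b]] by auto
qed

text \<open>The quotient \<open>|xz| / |yz|\<close> takes the same value at both ends of an axis harmonic to \<open>{x, y}\<close>, it is
  inverted when \<open>x\<close> and \<open>y\<close> are exchanged, and its ratio at two points is a cross-ratio. So its
  logarithm is an arc length coordinate on the line, determined up to sign and an additive constant.\<close>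

lemma axis_dist_eq:
  assumes M: "moebius_structure S1 M" "d \<in> M"
    and q: "({x, y}, {z, u}) \<in> Harm M" and q': "({x, y}, {z', u'}) \<in> Harm M"
  shows "axis_dist M {x, y} {z, u} {z', u'} =
    \<bar>ln (factor d x z / factor d y z) - ln (factor d x z' / factor d y z')\<bar>"
proof -
  let ?l = "\<lambda>e v w t. ln (factor e v t / factor e w t)"
  have pos: "0 < factor e v w" if "e \<in> M" "v \<in> S1" "w \<in> S1" "v \<noteq> w" for e v w
    using factor_pos[OF moebius_structure_semimetric[OF M(1)]] that by blast
  have expand: "ln (factor e v t' * factor e w t / (factor e v t * factor e w t')) =
      ?l e v w t' - ?l e v w t"
    if "e \<in> M" "{v, w, t, t'} \<subseteq> S1" "v \<noteq> t" "v \<noteq> t'" "w \<noteq> t" "w \<noteq> t'" for e v w t t'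
    using pos[OF that(1), of v t] pos[OF that(1), of w t] pos[OF that(1), of v t'] 
      pos[OF that(1), of w t'] that by (simp add: ln_mult ln_div)
  have swap: "?l e w v t = - ?l e v w t" if "e \<in> M" "{v, w, t} \<subseteq> S1" "v \<noteq> t" "w \<noteq> t" for e v w t
    using pos[OF that(1), of v t] pos[OF that(1), of w t] that by (simp add: ln_div)
  have harm: "?l e x y z = ?l e x y u" if "({x, y}, {z, u}) \<in> Harm M" "e \<in> M" for e x y z u
  proof -
    note h = Harm_labelled[OF M(1) that(2,1)]
    have "factor e y z \<noteq> 0" "factor e y u \<noteq> 0"
      using pos[OF that(2), of y z] pos[OF that(2), of y u] h by auto
    then have "factor e x z / factor e y z = factor e x u / factor e y u"
      using h by (simp add: field_simps)
    then show ?thesis by simp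
  qed
  have transfer: "?l e x y z' - ?l e x y z = ?l d x y z' - ?l d x y z" if "e \<in> M" for e
  proof (cases "z = z'")
    \<comment> \<open>For \<open>z = z'\<close> the four points are not distinct, but then both sides vanish.\<close>
    case False
    note h = Harm_labelled[OF M q] and h' = Harm_labelled[OF M q']
    have "cr1 e x y z' z = cr1 d x y z' z"
      using cross_ratio_transfer[OF M(1) that M(2)] h h' False by auto
    then have "ln (factor e x z' * factor e y z / (factor e x z * factor e y z')) =
       ln (factor d x z' * factor d y z / (factor d x z * factor d y z'))"
      unfolding cr1_def by simp
    then show ?thesis
      using h h' expand[OF that, of x y z z'] expand[OF M(2), of x y z z'] by simp
  qed simp
  show ?thesis
    unfolding axis_dist_def
  proof (rule the_equality)
    note h = Harm_labelled[OF M q] and h' = Harm_labelled[OF M q']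
    have "\<bar>ln (factor d x z / factor d y z) - ln (factor d x z' / factor d y z')\<bar> =
      \<bar>ln (factor d x z' * factor d y z / (factor d x z * factor d y z'))\<bar>"
      using h h' expand[OF M(2), of x y z z'] by (simp add: abs_minus_commute)
    then show "\<exists>e\<in>M. \<exists>x1 y1 z1 u1 z1' u1'. {x, y} = {x1, y1} \<and> {z, u} = {z1, u1} \<and> {z', u'} = {z1', u1'} \<and>
        \<bar>?l d x y z - ?l d x y z'\<bar> =
        \<bar>ln (factor e x1 z1' * factor e y1 z1 / (factor e x1 z1 * factor e y1 z1'))\<bar>"
      using M(2) by blast
  next
    fix r
    assume "\<exists>e\<in>M. \<exists>x1 y1 z1 u1 z1' u1'. {x, y} = {x1, y1} \<and> {z, u} = {z1, u1} \<and> {z', u'} = {z1', u1'} \<and>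
        r = \<bar>ln (factor e x1 z1' * factor e y1 z1 / (factor e x1 z1 * factor e y1 z1'))\<bar>"
    then obtain e x1 y1 z1 u1 z1' u1' where e: "e \<in> M" and
      eqs: "{x, y} = {x1, y1}" "{z, u} = {z1, u1}" "{z', u'} = {z1', u1'}" and
      r: "r = \<bar>ln (factor e x1 z1' * factor e y1 z1 / (factor e x1 z1 * factor e y1 z1'))\<bar>"
      by blast
    have q1: "({x1, y1}, {z1, u1}) \<in> Harm M" "({x1, y1}, {z1', u1'}) \<in> Harm M"
      using q q' eqs by auto
    note h = Harm_labelled[OF M(1) e q1(1)] and h' = Harm_labelled[OF M(1) e q1(2)]
    have "r = \<bar>?l e x1 y1 z1' - ?l e x1 y1 z1\<bar>"
      using expand[OF e, of x1 y1 z1 z1'] h h' r by simp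
    also have "\<dots> = \<bar>?l e x y z1' - ?l e x y z1\<bar>"
      using eqs(1) swap[OF e, of x1 y1 z1] swap[OF e, of x1 y1 z1'] h h'
      by (auto simp: doubleton_eq_iff)
    also have "\<dots> = \<bar>?l e x y z' - ?l e x y z\<bar>"
      using harm[OF q e] harm[OF q' e] eqs(2,3) by (auto simp: doubleton_eq_iff)
    also have "\<dots> = \<bar>?l d x y z - ?l d x y z'\<bar>"
      using transfer[OF e] by (simp add: abs_minus_commute)
    finally show "r = \<bar>?l d x y z - ?l d x y z'\<bar>" .
  qed
qed

text \<open>The two monotonicities of the Lipschitz bound, \<open>min C A / u\<^sup>2\<close> not increasing and \<open>min C A\<close> not
  decreasing, in numbers.\<close>

lemma scaled_min_lipschitz:
  fixes C A A' u u' :: real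
  assumes pos: "0 < C" "0 < A" "0 < A'" "0 < u" and le: "u \<le> u'"
    and up: "A' / u'^2 \<le> A / u^2" and mono: "A' < C \<Longrightarrow> A \<le> A'"
  shows "\<bar>ln (min C A / u) - ln (min C A' / u')\<bar> \<le> ln u' - ln u"
proof -
  define m m' where "m = min C A" and "m' = min C A'"
  have p: "0 < m" "0 < m'" "0 < u'"
    using pos le by (auto simp: m_def m'_def)
  have "m \<le> m'"
    using mono unfolding m_def m'_def by (cases "A' < C") auto
  moreover have "m' \<le> m * (u'^2 / u^2)"
  proof (cases "C \<le> A")
    case True
    have "1 \<le> u'^2 / u^2"
      using pos le by (simp add: power_mono)
    then have "C * 1 \<le> C * (u'^2 / u^2)"
      using pos by (intro mult_left_mono) auto
    then show ?thesis using True by (auto simp: m_def m'_def)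
  next
    case False
    have "A' \<le> A * (u'^2 / u^2)"
      using up pos p by (simp add: field_simps)
    then show ?thesis using False by (auto simp: m_def m'_def)
  qed
  then have "ln m' \<le> ln (m * (u'^2 / u^2))"
    using p by simp
  then have "ln m' \<le> ln m + 2 * (ln u' - ln u)"
    using p pos by (simp add: ln_mult ln_div ln_realpow)
  moreover have quot: "ln (m / u) = ln m - ln u" "ln (m' / u') = ln m' - ln u'"
    using p pos by (simp_all add: ln_div)
  moreover have "ln m \<le> ln m'" using \<open>m \<le> m'\<close> p by simp
  ultimately have "\<bar>(ln m - ln u) - (ln m' - ln u')\<bar> \<le> ln u' - ln u"
    by (simp add: abs_le_iff)
  then show ?thesis
    unfolding m_def[symmetric] m'_def[symmetric] quot by (simp add: abs_le_iff)
qed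

section \<open>A punctured circle as a line: quasi-concavity from the Increment Axiom\<close>

text \<open>The axioms of a monotone Moebius structure as they appear in an angular coordinate on the circle without the
  infinitely remote point \<open>\<omega>\<close>. The inequalities \<open>D_four\<close> are Axiom (M) for four finite points, \<open>D_three\<close> is
  Axiom (M) for three finite points and \<open>\<omega>\<close>. The last two assumptions are the Increment Axiom with \<open>\<omega>\<close> as sixth
  point and \<open>o'\<close> as seventh, for the two orientations; a 4-tuple with \<open>\<omega>\<close> is harmonic when the centre \<open>z\<close> has equal
  distances to the other two points.\<close>

locale punctured_line =
  fixes lo hi :: real and D :: "real \<Rightarrow> real \<Rightarrow> real"
  assumes D_sym: "D s t = D t s"
    and D_refl: "D s s = 0"
    and D_pos: "\<lbrakk>lo < s; s < hi; lo < t; t < hi; s \<noteq> t\<rbrakk> \<Longrightarrow> 0 < D s t"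
    and D_cont: "lo < s \<Longrightarrow> s < hi \<Longrightarrow> continuous_on {lo<..<hi} (D s)"
    and D_four: "\<lbrakk>lo < s; s < t; t < u; u < v; v < hi\<rbrakk> \<Longrightarrow>
        D s t * D u v < D s u * D t v \<and> D s v * D t u < D s u * D t v"
    and D_three: "\<lbrakk>lo < s; s < t; t < u; u < hi\<rbrakk> \<Longrightarrow> D s t < D s u \<and> D t u < D s u"
    and D_incr_left: "\<lbrakk>lo < o'; o' < x1; x1 < x2; x2 < z; z < x4; x4 < x5; x5 < hi;
        D z x1 = D z x5; D z x2 = D z x4\<rbrakk> \<Longrightarrow> D o' x1 * D o' x5 < D o' x2 * D o' x4"
    and D_incr_right: "\<lbrakk>lo < x1; x1 < x2; x2 < z; z < x4; x4 < x5; x5 < o'; o' < hi;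
        D z x1 = D z x5; D z x2 = D z x4\<rbrakk> \<Longrightarrow> D o' x1 * D o' x5 < D o' x2 * D o' x4"
begin

lemma reflected: "punctured_line (- hi) (- lo) (\<lambda>s t. D (- s) (- t))"
proof
  fix s assume "- hi < s" "s < - lo"
  then have "continuous_on {lo<..<hi} (D (- s))"
    by (intro D_cont) auto
  then show "continuous_on {- hi<..<- lo} (\<lambda>t. D (- s) (- t))"
    by (rule continuous_on_compose2) (auto intro!: continuous_intros)
next
  fix s t u v assume "- hi < s" "s < t" "t < u" "u < v" "v < - lo"
  then show "D (- s) (- t) * D (- u) (- v) < D (- s) (- u) * D (- t) (- v) \<and>
      D (- s) (- v) * D (- t) (- u) < D (- s) (- u) * D (- t) (- v)"
    using D_four[of "- v" "- u" "- t" "- s"] by (simp add: D_sym mult.commute)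
next
  fix s t u assume "- hi < s" "s < t" "t < u" "u < - lo"
  then show "D (- s) (- t) < D (- s) (- u) \<and> D (- t) (- u) < D (- s) (- u)"
    using D_three[of "- u" "- t" "- s"] by (simp add: D_sym)
next
  fix o' x1 x2 z x4 x5
  assume "- hi < o'" "o' < x1" "x1 < x2" "x2 < z" "z < x4" "x4 < x5" "x5 < - lo"
    "D (- z) (- x1) = D (- z) (- x5)" "D (- z) (- x2) = D (- z) (- x4)"
  then show "D (- o') (- x1) * D (- o') (- x5) < D (- o') (- x2) * D (- o') (- x4)"
    using D_incr_right[of "- x5" "- x4" "- z" "- x2" "- x1" "- o'"] by (simp add: mult.commute)
next
  fix o' x1 x2 z x4 x5
  assume "- hi < x1" "x1 < x2" "x2 < z" "z < x4" "x4 < x5" "x5 < o'" "o' < - lo"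
    "D (- z) (- x1) = D (- z) (- x5)" "D (- z) (- x2) = D (- z) (- x4)"
  then show "D (- o') (- x1) * D (- o') (- x5) < D (- o') (- x2) * D (- o') (- x4)"
    using D_incr_left[of "- o'" "- x5" "- x4" "- z" "- x2" "- x1"] by (simp add: mult.commute)
qed (auto simp: D_sym D_refl intro: D_pos)

text \<open>The nearer of two points on either side of \<open>z\<close> is matched on the other side by the intermediate value
  theorem.\<close>

lemma symmetric_pair_near:
  assumes "lo \<le> l" "l < z" "z < r" "r \<le> hi"
  obtains x y where "l < x" "x < z" "z < y" "y < r" "D z x = D z y"
proof -
  define a b where "a = (l + z) / 2" and "b = (z + r) / 2"
  have ab: "l < a" "a < z" "z < b" "b < r" "lo < a" "b < hi"
    using assms by (auto simp: a_def b_def)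
  have cont: "continuous_on {x..y} (D z)" if "lo < x" "y < hi" for x y
    using D_cont[of z] assms that by (auto intro: continuous_on_subset)
  have posa: "0 < D z a" "0 < D z b"
    using D_pos assms ab by auto
  show thesis
  proof (cases "D z a \<le> D z b")
    case True
    have "\<exists>y. z \<le> y \<and> y \<le> b \<and> D z y = D z a"
      using True ab posa cont[of z b] assms by (intro IVT') (auto simp: D_refl)
    then obtain y where "z \<le> y" "y \<le> b" "D z y = D z a" by blast
    moreover from this have "y \<noteq> z" using posa D_refl[of z] by auto
    ultimately show thesis using that[of a y] ab by auto
  next
    case False
    have "\<exists>x. a \<le> x \<and> x \<le> z \<and> D z x = D z b"
      using False ab posa cont[of a z] assms by (intro IVT2') (auto simp: D_refl)
    then obtain x where "a \<le> x" "x \<le> z" "D z x = D z b" by blast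
    moreover from this have "x \<noteq> z" using posa D_refl[of z] by auto
    ultimately show thesis using that[of x b] ab by auto
  qed
qed

lemma midpoint_exists:
  assumes "lo < p" "p < q" "q < hi"
  obtains m where "p < m" "m < q" "D p m = D q m"
proof -
  have "continuous_on {p..q} (\<lambda>x. D p x - D q x)"
    using D_cont[of p] D_cont[of q] assms
    by (intro continuous_intros) (auto intro: continuous_on_subset)
  moreover have "D p p - D q p \<le> 0" "0 \<le> D p q - D q q"
    using D_pos[of p q] D_sym[of p q] assms by (auto simp: D_refl)
  ultimately obtain m where m: "p \<le> m" "m \<le> q" "D p m - D q m = 0"
    using IVT'[of "\<lambda>x. D p x - D q x" p 0 q] assms by auto
  then have "m \<noteq> p" "m \<noteq> q"
    using D_pos[of p q] D_sym[of p q] assms by (auto simp: D_refl)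
  then show thesis using m that[of m] by auto
qed

lemma product_nested_pairs:
  assumes "lo < a" "a < x1" "x1 < x2" "x2 < z" "z < x4" "x4 < x5" "x5 < b" "b < hi"
    and "D z x1 = D z x5" "D z x2 = D z x4"
  shows "(D a x1 * D b x1) * (D a x5 * D b x5) < (D a x2 * D b x2) * (D a x4 * D b x4)"
proof -
  have "D a x1 * D a x5 < D a x2 * D a x4"
    using assms by (intro D_incr_left[of a x1 x2 z x4 x5]) auto
  moreover have "D b x1 * D b x5 < D b x2 * D b x4"
    using assms by (intro D_incr_right[of x1 x2 z x4 x5 b]) auto
  moreover have "0 < D a x1 * D a x5" "0 < D b x1 * D b x5"
    using assms by (auto intro!: mult_pos_pos D_pos)
  ultimately have "(D a x1 * D a x5) * (D b x1 * D b x5) < (D a x2 * D a x4) * (D b x2 * D b x4)"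
    by (intro mult_strict_mono'[of "D a x1 * D a x5"]) auto
  then show ?thesis by (simp add: mult_ac)
qed

text \<open>The strictly nested pairs of the Increment Axiom are contracted to the centre \<open>z\<close> itself. An
  intermediate pair \<open>x2, y2\<close> keeps the inequality strict.\<close>

lemma product_symmetric_pair:
  assumes "lo < a" "a < x" "x < z" "z < y" "y < b" "b < hi" and eq: "D z x = D z y"
  shows "(D a x * D b x) * (D a y * D b y) < (D a z * D b z)^2"
proof -
  define g where "g = (\<lambda>w. D a w * D b w)"
  obtain x2 y2 where xy2: "x < x2" "x2 < z" "z < y2" "y2 < y" "D z x2 = D z y2"
    by (rule symmetric_pair_near[of x z y]) (use assms in auto)
  have "g x * g y < g x2 * g y2"
    using product_nested_pairs[of a x x2 z y2 y b] assms xy2 by (simp add: g_def)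
  moreover have "g x2 * g y2 \<le> g z * g z"
  proof (rule ccontr)
    assume less: "\<not> g x2 * g y2 \<le> g z * g z"
    have cont: "continuous_on {lo<..<hi} g"
      using assms unfolding g_def by (intro continuous_intros D_cont) auto
    have "isCont g z"
      using cont assms by (simp add: continuous_on_eq_continuous_at)
    then have lim: "g \<midarrow>z\<rightarrow> g z" by (simp add: isCont_def)
    have gz: "0 < g z" unfolding g_def using assms by (intro mult_pos_pos D_pos) auto
    \<comment> \<open>If the product at \<open>x2, y2\<close> exceeded that at \<open>z\<close>, then by continuity both values of \<open>g\<close> on a pair close
      to \<open>z\<close> would lie below the geometric mean \<open>e\<close>, against the growth of the product towards \<open>z\<close>.\<close>
    define e where "e = sqrt (g x2 * g y2)"
    have e: "g z < e" "e * e = g x2 * g y2"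
      using less gz by (auto simp: e_def not_le power2_eq_square real_less_rsqrt)
         (metis abs_of_nonneg less_eq_real_def mult_pos_pos order_less_trans real_sqrt_mult_self)
    have "eventually (\<lambda>w. g w < e) (at z)"
      using lim e(1) by (rule order_tendstoD)
    then obtain \<epsilon> where eps: "\<epsilon> > 0" "\<And>w. w \<noteq> z \<Longrightarrow> dist w z < \<epsilon> \<Longrightarrow> g w < e"
      unfolding eventually_at by auto
    obtain x3 y3 where xy3: "max x2 (z - \<epsilon>) < x3" "x3 < z" "z < y3" "y3 < min y2 (z + \<epsilon>)"
      "D z x3 = D z y3"
      by (rule symmetric_pair_near[of "max x2 (z - \<epsilon>)" z "min y2 (z + \<epsilon>)"]) (use assms xy2 eps in auto)
    have "g x3 < e" "g y3 < e"
      using xy3 by (auto intro!: eps simp: dist_real_def)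
    moreover have "0 < g x3" "0 < g y3"
      unfolding g_def using assms xy2 xy3 by (auto intro!: mult_pos_pos D_pos)
    ultimately have "g x3 * g y3 < e * e"
      by (intro mult_strict_mono) auto
    moreover have "g x2 * g y2 < g x3 * g y3"
      using product_nested_pairs[of a x2 x3 z y3 y2 b] assms xy2 xy3 by (simp add: g_def)
    ultimately show False using e by simp
  qed
  ultimately show ?thesis by (simp add: g_def power2_eq_square)
qed

text \<open>If the value at \<open>x\<close> exceeded the value at \<open>y\<close>, the product would attain its minimum over \<open>[x, w]\<close> in the
  interior, and a symmetric pair around the minimum contradicts \<open>product_symmetric_pair\<close>.\<close>

lemma product_quasi_concave:
  assumes "lo < a" "a < x" "x < y" "y < w" "w < b" "b < hi"
    and less: "D a y * D b y < D a w * D b w"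
  shows "D a x * D b x \<le> D a y * D b y"
proof (rule ccontr)
  define g where "g = (\<lambda>w. D a w * D b w)"
  assume "\<not> ?thesis"
  then have gx: "g y < g x" by (simp add: g_def)
  have gw: "g y < g w" using less by (simp add: g_def)
  have "continuous_on {lo<..<hi} g"
    using assms unfolding g_def by (intro continuous_intros D_cont) auto
  then have "continuous_on {x..w} g"
    using assms by (elim continuous_on_subset) auto
  then obtain z where z: "z \<in> {x..w}" "\<And>v. v \<in> {x..w} \<Longrightarrow> g z \<le> g v"
    using continuous_attains_inf[of "{x..w}" g] assms by auto
  have "z \<noteq> x" "z \<noteq> w" using z(2)[of y] assms gx gw by auto
  then have zi: "x < z" "z < w" using z by auto
  obtain p q where pq: "x < p" "p < z" "z < q" "q < w" "D z p = D z q"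
    by (rule symmetric_pair_near[of x z w]) (use zi assms in auto)
  have "g p * g q < g z * g z"
    using product_symmetric_pair[of a p z q b] pq assms by (simp add: g_def power2_eq_square)
  moreover have "g z * g z \<le> g p * g q"
  proof (intro mult_mono)
    show "0 \<le> g z" "0 \<le> g p" unfolding g_def using assms zi pq
      by (auto intro!: mult_nonneg_nonneg less_imp_le[OF D_pos])
  qed (use pq zi z in auto)
  ultimately show False by simp
qed

section \<open>The height along a line of harmonic pairs\<close>

text \<open>The logarithm of the level is the arc length coordinate, along the line with axis \<open>p, q\<close>, of the harmonic
  pair whose other axis has an end at \<open>r\<close>.\<close>

definition level :: "real \<Rightarrow> real \<Rightarrow> real \<Rightarrow> real" where
  "level p q r = D p r / D q r"

text \<open>The number \<open>h\<close> is the height of a harmonic pair with axes \<open>p, q\<close> and \<open>r, s\<close>, where \<open>p < r < q\<close>. The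
  three predicates differ in the position of the end \<open>s\<close>: to the right of \<open>q\<close>, to the left of \<open>p\<close>, or at the
  infinitely remote point, where harmonicity makes \<open>r\<close> the midpoint of \<open>p\<close> and \<open>q\<close>.\<close>

definition height_right :: "real \<Rightarrow> real \<Rightarrow> real \<Rightarrow> real \<Rightarrow> bool" where
  "height_right p q r h \<longleftrightarrow> (\<exists>s. q < s \<and> s < hi \<and> D p r * D q s = D p s * D q r \<and>
     h = min (D p q) (D r s * D p r / D q s) / level p q r)"

definition height_left :: "real \<Rightarrow> real \<Rightarrow> real \<Rightarrow> real \<Rightarrow> bool" where
  "height_left p q r h \<longleftrightarrow> (\<exists>s. lo < s \<and> s < p \<and> D p r * D q s = D p s * D q r \<and>
     h = min (D p q) (D r s * D q r / D p s) * level p q r)"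

definition height_mid :: "real \<Rightarrow> real \<Rightarrow> real \<Rightarrow> real \<Rightarrow> bool" where
  "height_mid p q r h \<longleftrightarrow> D p r = D q r \<and> h = D p r"

lemma level_mono:
  assumes "lo < p" "p < r" "r < r'" "r' < q" "q < hi"
  shows "level p q r < level p q r'"
proof -
  have "D p r < D p r'" "D q r' < D q r"
    using D_three[of p r r'] D_three[of r r' q] assms by (auto simp: D_sym)
  moreover have "0 < D p r" "0 < D q r'"
    using assms by (auto intro!: D_pos)
  ultimately show ?thesis unfolding level_def
    by (intro frac_less2) auto
qed

lemma level_right:
  assumes "lo < p" "p < r" "r < q" "q < s" "s < hi" "D p r * D q s = D p s * D q r"
  shows "level p q r = D p s / D q s" "1 < level p q r"
proof -
  have pos: "0 < D q s" "0 < D q r" using assms by (auto intro!: D_pos)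
  show "level p q r = D p s / D q s"
    using pos assms unfolding level_def by (simp add: field_simps)
  moreover have "D q s < D p s" using D_three[of p q s] assms by auto
  ultimately show "1 < level p q r" using pos by simp
qed

text \<open>The core of the argument. The bound on the growth of \<open>min C A\<close> comes from Axiom (M); that \<open>min C A\<close> does not
  decrease is quasi-concavity of the product of the distances to \<open>p\<close> and \<open>s'\<close>.\<close>

lemma height_right_lipschitz:
  assumes "lo < p" "p < r" "r < r'" "r' < q" "q < hi"
    and "height_right p q r h" "height_right p q r' h'"
  shows "\<bar>ln h - ln h'\<bar> \<le> ln (level p q r') - ln (level p q r)"
proof -
  obtain s where s: "q < s" "s < hi" "D p r * D q s = D p s * D q r"
      "h = min (D p q) (D r s * D p r / D q s) / level p q r"
    using assms by (auto simp: height_right_def)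
  obtain s' where s': "q < s'" "s' < hi" "D p r' * D q s' = D p s' * D q r'"
      "h' = min (D p q) (D r' s' * D p r' / D q s') / level p q r'"
    using assms by (auto simp: height_right_def)
  note lev = level_right[of p r q s] level_right[of p r' q s']
  have levlt: "level p q r < level p q r'" using level_mono assms by blast
  \<comment> \<open>The ends of the moving axis approach \<open>q\<close> from both sides.\<close>
  have ss: "s' < s"
  proof (rule ccontr)
    assume "\<not> s' < s"
    then consider "s = s'" | "s < s'" by fastforce
    then show False
    proof cases
      case 1 then show False using lev levlt assms s s' by auto
    next
      case 2
      have "D p s' * D q s < D p s * D q s'"
        using D_four[of p q s s'] 2 s s' assms by auto
      moreover have "0 < D q s" "0 < D q s'" using s s' assms by (auto intro!: D_pos)
      ultimately have "D p s' / D q s' < D p s / D q s" by (simp add: field_simps)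
      then show False using lev levlt assms s s' by auto
    qed
  qed
  have pos: "0 < D p q" "0 < D r s" "0 < D p r" "0 < D q s" "0 < D q r" "0 < D p s"
     "0 < D r' s'" "0 < D p r'" "0 < D q s'" "0 < D q r'" "0 < D p s'" "0 < D r s'"
    using assms s s' by (auto intro!: D_pos)
  show ?thesis unfolding s(4) s'(4)
  proof (rule scaled_min_lipschitz)
    have *: "D r s * D p r / D q s / (level p q r)^2 = (D r s / D p s) * D q r"
      if "level p q r = D p r / D q r" "level p q r = D p s / D q s"
        "0 < D p r" "0 < D q r" "0 < D p s" "0 < D q s" for r s
    proof -
      have "(level p q r)^2 = (D p r / D q r) * (D p s / D q s)"
        using that by (simp add: power2_eq_square)
      then show ?thesis using that by simp
    qed
    have "D r' s' / D p s' \<le> D r s' / D p s'"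
      using D_three[of r r' s'] assms s s' pos by (auto intro!: divide_right_mono)
    also have "\<dots> \<le> D r s / D p s"
      using D_four[of p r s' s] assms s s' ss pos by (auto simp: field_simps)
    finally have "(D r' s' / D p s') * D q r' \<le> (D r s / D p s) * D q r"
      using D_three[of r r' q] assms pos by (intro mult_mono) (auto simp: D_sym)
    then show "D r' s' * D p r' / D q s' / (level p q r')^2 \<le> D r s * D p r / D q s / (level p q r)^2"
      using *[of r s] *[of r' s'] lev assms s s' pos by (simp add: level_def)
  next
    \<comment> \<open>The assumption compares the product of the distances to \<open>p\<close> and \<open>s'\<close> at \<open>r'\<close> with its value at \<open>q\<close>.\<close>
    assume "D r' s' * D p r' / D q s' < D p q"
    then have "D p r' * D s' r' < D p q * D s' q"
      using pos by (simp add: field_simps D_sym)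
    then have "D p r * D s' r \<le> D p r' * D s' r'"
      using assms s' by (intro product_quasi_concave[of p r r' q s']) auto
    then have "D r s' * D p r / D q s' \<le> D r' s' * D p r' / D q s'"
      using pos by (simp add: D_sym divide_right_mono mult.commute)
    moreover have "D r s / D q s \<le> D r s' / D q s'"
      using D_four[of r q s' s] assms s s' ss pos by (auto simp: field_simps)
    then have "D r s / D q s * D p r \<le> D r s' / D q s' * D p r"
      using pos by (intro mult_right_mono) auto
    ultimately show "D r s * D p r / D q s \<le> D r' s' * D p r' / D q s'"
      by (simp add: mult.commute)
  qed (use pos levlt lev assms s s' in \<open>auto simp: level_def\<close>)
qed

text \<open>Starting with \<open>s\<close> at the infinitely remote point the number \<open>A\<close> degenerates to \<open>|pr|\<close>, and both
  monotonicities are separation inequalities of Axiom (M).\<close>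

lemma height_mid_right_lipschitz:
  assumes "lo < p" "p < r" "r < r'" "r' < q" "q < hi"
    and "height_mid p q r h" "height_right p q r' h'"
  shows "\<bar>ln h - ln h'\<bar> \<le> ln (level p q r') - ln (level p q r)"
proof -
  have h: "D p r = D q r" "h = D p r" using assms by (auto simp: height_mid_def)
  obtain s' where s': "q < s'" "s' < hi" "D p r' * D q s' = D p s' * D q r'"
      "h' = min (D p q) (D r' s' * D p r' / D q s') / level p q r'"
    using assms by (auto simp: height_right_def)
  have pos: "0 < D p q" "0 < D p r" "0 < D q r"
     "0 < D r' s'" "0 < D p r'" "0 < D q s'" "0 < D q r'" "0 < D p s'"
    using assms s' by (auto intro!: D_pos)
  note lev = level_right[of p r' q s']
  have l1: "level p q r = 1" using h pos by (simp add: level_def)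
  have "h = min (D p q) (D p r) / level p q r"
    using D_three[of p r q] assms h l1 by auto
  then show ?thesis unfolding s'(4)
  proof (elim ssubst, intro scaled_min_lipschitz)
    have "(level p q r')^2 = (D p r' / D q r') * (D p s' / D q s')"
      using lev assms s' by (simp add: power2_eq_square level_def)
    then have "D r' s' * D p r' / D q s' / (level p q r')^2 = (D r' s' / D p s') * D q r'"
      using pos by simp
    also have "\<dots> \<le> 1 * D q r"
      using D_three[of p r' s'] D_three[of r r' q] assms pos s'
      by (intro mult_mono) (auto simp: D_sym)
    finally show "D r' s' * D p r' / D q s' / (level p q r')^2 \<le> D p r / (level p q r)^2"
      using h l1 by simp
  next
    have "D p r \<le> D p r'" using D_three[of p r r'] assms by auto
    also have "\<dots> \<le> D r' s' / D q s' * D p r'"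
    proof -
      have "1 \<le> D r' s' / D q s'" using D_three[of r' q s'] assms s' pos by simp
      then show ?thesis using pos mult_right_mono[of 1 "D r' s' / D q s'" "D p r'"] by simp
    qed
    finally show "D p r \<le> D r' s' * D p r' / D q s'" by simp
  qed (use pos l1 lev assms s' in auto)
qed

lemma height_upper_lipschitz:
  assumes pq: "lo < p" "p < r" "r < q" "p < r'" "r' < q" "q < hi"
    and "height_right p q r h \<or> height_mid p q r h" "height_right p q r' h' \<or> height_mid p q r' h'"
  shows "\<bar>ln h - ln h'\<bar> \<le> \<bar>ln (level p q r) - ln (level p q r')\<bar>"
proof -
  have right: "1 < level p q r" if "height_right p q r h" "p < r" "r < q" for r h
    using that level_right(2)[of p r q] pq by (auto simp: height_right_def)
  have mid: "level p q r = 1" if "height_mid p q r h" "p < r" "r < q" for r h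
    using that D_pos[of q r] pq by (auto simp: height_mid_def level_def)
  \<comment> \<open>The point \<open>r\<close> determines the other end \<open>s\<close>, hence the height.\<close>
  have eq: "h = h'" if "r = r'"
  proof -
    have "s = s'" if "q < s" "s < hi" "D p r * D q s = D p s * D q r"
      "q < s'" "s' < hi" "D p r * D q s' = D p s' * D q r" for s s'
    proof (rule ccontr)
      assume "s \<noteq> s'"
      then have "D p s * D q s' \<noteq> D p s' * D q s"
        using D_four[of p q s s'] D_four[of p q s' s] pq that by fastforce
      moreover have "D p s / D q s = D p s' / D q s'"
        using level_right(1)[of p r q s] level_right(1)[of p r q s'] pq that by simp
      moreover have "0 < D q s" "0 < D q s'" using pq that by (auto intro!: D_pos)
      ultimately show False by (simp add: field_simps)
    qed
    then have "h = h'" if "height_right p q r h" "height_right p q r h'"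
      using that unfolding height_right_def by metis
    moreover have "h = h'" if "height_mid p q r h" "height_mid p q r h'"
      using that unfolding height_mid_def by simp
    ultimately show ?thesis
      using assms(7,8) right[of r] mid[of r] pq \<open>r = r'\<close> by fastforce
  qed
  have ordered: "\<bar>ln h - ln h'\<bar> \<le> \<bar>ln (level p q r) - ln (level p q r')\<bar>"
    if r: "p < r" "r < r'" "r' < q"
      and c: "height_right p q r h \<or> height_mid p q r h" "height_right p q r' h' \<or> height_mid p q r' h'"
    for r r' h h'
  proof -
    have "level p q r < level p q r'" using level_mono r pq by blast
    then have "height_right p q r' h'"
      using right[of r h] mid[of r h] mid[of r' h'] c r by auto
    then show ?thesis
      using c height_right_lipschitz[of p r r' q h h'] height_mid_right_lipschitz[of p r r' q h h'] r pq
      by fastforce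
  qed
  show ?thesis
    using ordered[of r r' h h'] ordered[of r' r h' h] eq assms
    by (cases r r' rule: linorder_cases) auto
qed

lemma height_lower_lipschitz:
  assumes pq: "lo < p" "p < r" "r < q" "p < r'" "r' < q" "q < hi"
    and "height_left p q r h \<or> height_mid p q r h" "height_left p q r' h' \<or> height_mid p q r' h'"
  shows "\<bar>ln h - ln h'\<bar> \<le> \<bar>ln (level p q r) - ln (level p q r')\<bar>"
proof -
  interpret R: punctured_line "- hi" "- lo" "\<lambda>s t. D (- s) (- t)" by (rule reflected)
  have lev: "R.level (- q) (- p) (- r) = 1 / level p q r" for r
    by (simp add: R.level_def level_def)
  have left: "R.height_right (- q) (- p) (- r) h" if c: "height_left p q r h" for r h
  proof -
    obtain s where "lo < s" "s < p" "D p r * D q s = D p s * D q r"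
     "h = min (D p q) (D r s * D q r / D p s) * level p q r"
      using c by (auto simp: height_left_def)
    then have "D (- (- q)) (- (- r)) * D (- (- p)) (- (- s)) = D (- (- q)) (- (- s)) * D (- (- p)) (- (- r))"
      "h = min (D (- (- q)) (- (- p))) (D (- (- r)) (- (- s)) * D (- (- q)) (- (- r)) / D (- (- p)) (- (- s)))
         / (1 / level p q r)"
      using D_sym[of p q] by (simp_all add: mult.commute)
    then show ?thesis unfolding R.height_right_def lev
      using \<open>lo < s\<close> \<open>s < p\<close> by (intro exI[of _ "- s"]) simp
  qed
  have mid: "R.height_mid (- q) (- p) (- r) h" if "height_mid p q r h" for r h
    using that by (auto simp: R.height_mid_def height_mid_def)
  have pos: "0 < level p q r" "0 < level p q r'"
    unfolding level_def using pq by (auto intro!: divide_pos_pos D_pos)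
  have "\<bar>ln h - ln h'\<bar> \<le> \<bar>ln (1 / level p q r) - ln (1 / level p q r')\<bar>"
    using R.height_upper_lipschitz[of "- q" "- r" "- p" "- r'" h h'] assms left[of r h] left[of r' h'] 
      mid[of r h] mid[of r' h']
    unfolding lev by auto
  then show ?thesis using pos by (simp add: ln_div)
qed

text \<open>The level is greater than \<open>1\<close> with \<open>s\<close> on the right, less than \<open>1\<close> with \<open>s\<close> on the left. So between a left and a
  right position the line passes the midpoint, where the level is \<open>1\<close>, and the two bounds add up.\<close>

lemma height_line_lipschitz:
  assumes pq: "lo < p" "p < r" "r < q" "p < r'" "r' < q" "q < hi"
    and c: "height_left p q r h \<or> height_mid p q r h \<or> height_right p q r h"
    and c': "height_left p q r' h' \<or> height_mid p q r' h' \<or> height_right p q r' h'"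
  shows "\<bar>ln h - ln h'\<bar> \<le> \<bar>ln (level p q r) - ln (level p q r')\<bar>"
proof -
  obtain m where m: "p < m" "m < q" "D p m = D q m"
    using midpoint_exists pq by (metis less_trans)
  define k where "k = D p m"
  have mk: "height_mid p q m k" using m by (auto simp: height_mid_def k_def)
  have lm: "level p q m = 1" using m D_pos[of q m] pq by (simp add: level_def)
  have right: "0 < ln (level p q r)" if "height_right p q r h" "p < r" "r < q" for r h
    using that level_right(2)[of p r q] pq by (intro ln_gt_zero) (auto simp: height_right_def)
  have left: "ln (level p q r) < 0" if c: "height_left p q r h" and "p < r" "r < q" for r h
  proof -
    obtain s where s: "lo < s" "s < p" "D p r * D q s = D p s * D q r"
      using c by (auto simp: height_left_def)
    have "D p s < D q s" using D_three[of s p q] s pq by (auto simp: D_sym)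
    moreover have p: "0 < D p s" "0 < D q r" "0 < D p r" "0 < D q s"
      using s pq that by (auto intro!: D_pos)
    ultimately have "level p q r < 1"
      using s by (simp add: level_def) (metis mult.commute mult_less_cancel_right_disj order_less_asym)
    moreover have "0 < level p q r" using p by (simp add: level_def)
    ultimately show ?thesis by simp
  qed
  have through_mid: "\<bar>ln h - ln h'\<bar> \<le> \<bar>ln (level p q r) - ln (level p q r')\<bar>"
    if "height_right p q r h" "height_left p q r' h'" "p < r" "r < q" "p < r'" "r' < q" for r r' h h'
    using height_upper_lipschitz[of p r q m h k] height_lower_lipschitz[of p r' q m h' k]
      right[of r h] left[of r' h'] that mk lm m pq by auto
  note upper = height_upper_lipschitz[OF pq, of h h'] and lower = height_lower_lipschitz[OF pq, of h h']
  have across: "\<bar>ln h - ln h'\<bar> \<le> \<bar>ln (level p q r) - ln (level p q r')\<bar>"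
    if "height_right p q r h \<and> height_left p q r' h' \<or> height_left p q r h \<and> height_right p q r' h'"
    using that
  proof
    assume "height_right p q r h \<and> height_left p q r' h'"
    then show ?thesis using through_mid[of r h r' h'] pq by blast
  next
    assume "height_left p q r h \<and> height_right p q r' h'"
    then show ?thesis using through_mid[of r' h' r h] pq by (metis abs_minus_commute)
  qed
  show ?thesis
    using c c' upper lower across by blast
qed

end

section \<open>Angular charts of a punctured circle\<close>

lemma cis_inj_period:
  assumes "cis s = cis t" "\<bar>s - t\<bar> < 2 * pi"
  shows "s = t"
proof -
  have "sin s = sin t \<and> cos s = cos t"
    using assms(1) by (metis cis.simps)
  then obtain n :: int where n: "s = t + 2 * pi * n"
    using sin_cos_eq_iff[of s t] by auto
  then have "\<bar>real_of_int n\<bar> < 1"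
    using assms(2) by (simp add: abs_mult)
  then show ?thesis using n by simp
qed

lemma angle_above:
  assumes "x \<in> S1"
  obtains t where "\<alpha> \<le> t" "t < \<alpha> + 2 * pi" "x = cis t"
proof -
  define z where "z = x * cis (- \<alpha>)"
  have "norm z = 1" using assms by (simp add: z_def norm_mult)
  then have "z = cis (Arg2pi z)"
    using complex_norm_eq_1_exp[of z] by (simp add: cis_conv_exp)
  then have "x = cis (\<alpha> + Arg2pi z)"
    by (metis z_def cis_mult cis_neq_zero cis_inverse mult.commute mult.assoc right_inverse mult_1_right cis_zero add.right_inverse)
  then show thesis
    using that[of "\<alpha> + Arg2pi z"] Arg2pi[of z] by auto
qed

lemma cis_turn: "cis (t + 2 * pi) = cis t"
  by (simp add: cis.ctr)

text \<open>Every point of the circle is \<open>cis \<alpha>\<close> for some \<open>\<alpha>\<close>, and every Moebius structure contains a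
  semi-metric with a prescribed infinitely remote point; the circle without \<open>cis \<alpha>\<close> is parametrized by the
  angles between \<open>\<alpha>\<close> and \<open>\<alpha> + 2 * pi\<close>.\<close>

locale based_moebius =
  fixes M :: "complex semimetric set" and d :: "complex semimetric" and \<alpha> :: real
  assumes moebius: "moebius_structure S1 M"
    and monotone: "monotone_moebius M"
    and increment: "increment_axiom M"
    and d_in: "d \<in> M"
    and remote: "infinitely_remote S1 d (cis \<alpha>)"
begin

abbreviation f :: "complex \<Rightarrow> complex \<Rightarrow> real" where "f \<equiv> factor d"
abbreviation \<omega> :: complex where "\<omega> \<equiv> cis \<alpha>"
abbreviation D :: "real \<Rightarrow> real \<Rightarrow> real" where "D s t \<equiv> f (cis s) (cis t)"

lemma semi: "is_semimetric S1 d"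
  using moebius_structure_semimetric moebius d_in .

lemma cis_S1 [simp]: "cis t \<in> S1" by simp

lemmas f_sym = factor_sym[OF semi] and f_pos = factor_pos[OF semi] and f_refl = factor_refl[OF semi]
  and f_remote = factor_remote[OF remote]

lemma cis_neq:
  assumes "\<alpha> \<le> s" "s < \<alpha> + 2 * pi" "\<alpha> \<le> t" "t < \<alpha> + 2 * pi" "s \<noteq> t"
  shows "cis s \<noteq> cis t"
  using cis_inj_period[of s t] assms by (auto simp: abs_less_iff)

text \<open>The angle \<open>s = \<alpha>\<close> is included, so that the inequalities for three finite points and \<open>\<omega>\<close> are special cases.\<close>

lemma cyclic_products:
  assumes "\<alpha> \<le> s" "s < t" "t < u" "u < v" "v < \<alpha> + 2 * pi"
  shows "D s t * D u v < D s u * D t v \<and> D s v * D t u < D s u * D t v"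
proof -
  have sep: "points_separated_by (cis s) (cis u) (cis t) (cis v)"
    unfolding points_separated_by_def open_arc_def using assms
    by (intro exI[of _ s] exI[of _ u]) auto
  \<comment> \<open>Axiom (M) asks for separation in both directions; in the second one the arcs from \<open>v\<close> to \<open>t\<close> pass the
    angle \<open>s + 2 * pi\<close>.\<close>
  have "cis s = cis (s + 2 * pi)"
    by (simp add: cis.ctr)
  then have "cis s \<in> open_arc v (t + 2 * pi)"
    using assms unfolding open_arc_def by (intro image_eqI[of _ _ "s + 2 * pi"]) auto
  moreover have "cis u = cis (u + 2 * pi)" "cis t = cis (t + 2 * pi)"
    by (simp_all add: cis.ctr)
  then have "cis u \<in> open_arc (t + 2 * pi) (v + 2 * pi)"
    using assms unfolding open_arc_def by (intro image_eqI[of _ _ "u + 2 * pi"]) auto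
  ultimately have "points_separated_by (cis t) (cis v) (cis s) (cis u)"
    unfolding points_separated_by_def using assms \<open>cis t = cis (t + 2 * pi)\<close>
    by (intro exI[of _ v] exI[of _ "t + 2 * pi"]) auto
  then obtain d' where d': "d' \<in> M" "factor d' (cis s) (cis u) * factor d' (cis t) (cis v) >
      max (factor d' (cis s) (cis t) * factor d' (cis u) (cis v))
          (factor d' (cis s) (cis v) * factor d' (cis u) (cis t))"
    using monotone sep unfolding monotone_moebius_def by (meson cis_S1)
  have dist: "distinct [cis s, cis u, cis t, cis v]" "distinct [cis u, cis s, cis t, cis v]"
    using cis_neq assms by auto
  have sym': "factor d' (cis s) (cis u) = factor d' (cis u) (cis s)"
    using factor_sym[OF moebius_structure_semimetric[OF moebius d'(1)]] by simp
  have "D s t * D u v < D s u * D t v"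
    using product_less_transfer[OF moebius d'(1) d_in _ _ _ _ dist(1)] d'(2) by simp
  moreover have "D u t * D s v < D u s * D t v"
    using product_less_transfer[OF moebius d'(1) d_in _ _ _ _ dist(2)] d'(2)
    by (simp add: sym' mult.commute)
  ultimately show ?thesis
    by (simp add: f_sym[of "cis u"] mult.commute)
qed

text \<open>Balls are open by Axiom (T), which controls \<open>d\<close> near the diagonal. The Ptolemy inequality with \<open>\<omega>\<close> as fourth
  point is the triangle inequality, which spreads this to all distances.\<close>

lemma D_continuous:
  assumes s: "\<alpha> < s" "s < \<alpha> + 2 * pi"
  shows "continuous_on {\<alpha><..<\<alpha> + 2 * pi} (D s)"
proof (rule continuous_onI)
  fix t e :: real
  assume t: "t \<in> {\<alpha><..<\<alpha> + 2 * pi}" and e: "0 < e"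
  have finite: "cis u \<noteq> \<omega>" if "u \<in> {\<alpha><..<\<alpha> + 2 * pi}" for u
    using that cis_neq[of u \<alpha>] by auto
  have triangle: "f x y \<le> f x z + f y z" if "x \<in> S1" "y \<in> S1" "z \<in> S1" "x \<noteq> \<omega>" "y \<noteq> \<omega>" "z \<noteq> \<omega>" for x y z
  proof -
    have "f x y * f z \<omega> \<le> f x z * f y \<omega> + f x \<omega> * f y z"
      using monotone d_in that unfolding monotone_moebius_def ptolemaic_def by (meson cis_S1)
    then show ?thesis using that by (simp add: f_remote)
  qed
  define B where "B = {y\<in>S1. d (cis t) y < ereal e}"
  have fin: "\<not> infinitely_remote S1 d (cis t)"
    using finite[OF t] semi remote unfolding is_semimetric_def by blast
  have "openin (moebius_topology S1 M) B"
    unfolding moebius_topology_def B_def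
    using d_in remote fin e by (intro topology_generated_by_Basis) fastforce
  then have "openin (top_of_set S1) B"
    using monotone by (simp add: monotone_moebius_def)
  then obtain U where U: "open U" "B = S1 \<inter> U" by (auto simp: openin_open)
  have "continuous_on UNIV cis" by (intro continuous_intros)
  then have "open (cis -` U)" using U by (simp add: continuous_open_vimage open_vimage)
  moreover have "cis t \<in> B"
    using e semi by (auto simp: B_def is_semimetric_def)
  then have "t \<in> cis -` U" using U by simp
  ultimately obtain \<delta> where \<delta>: "0 < \<delta>" "\<And>u. dist u t < \<delta> \<Longrightarrow> cis u \<in> U"
    unfolding open_dist by auto
  show "\<exists>\<delta>>0. \<forall>u\<in>{\<alpha><..<\<alpha> + 2 * pi}. dist u t < \<delta> \<longrightarrow> dist (D s u) (D s t) \<le> e"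
  proof (intro exI[of _ \<delta>] conjI ballI impI \<delta>(1))
    fix u assume u: "u \<in> {\<alpha><..<\<alpha> + 2 * pi}" "dist u t < \<delta>"
    have "cis u \<in> B" using \<delta>(2)[OF u(2)] U by simp
    then have "d (cis t) (cis u) < ereal e" by (simp add: B_def)
    moreover have "0 \<le> d (cis t) (cis u)"
      using semi unfolding is_semimetric_def by (metis cis_S1 less_imp_le order_refl)
    ultimately have "D t u < e"
      by (cases "d (cis t) (cis u)") (auto simp: factor_def)
    moreover have "D s u \<le> D s t + D t u" "D s t \<le> D s u + D t u"
      using triangle[of "cis s" "cis u" "cis t"] triangle[of "cis s" "cis t" "cis u"]
        finite[of s] finite[OF t] finite[OF u(1)] s f_sym[of "cis u" "cis t"] by auto
    ultimately show "dist (D s u) (D s t) \<le> e"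
      by (simp add: dist_real_def abs_le_iff)
  qed
qed

lemma increment_remote:
  assumes x: "\<forall>y\<in>{o', x1, x2, z, x4, x5}. \<alpha> < y \<and> y < \<alpha> + 2 * pi"
    and dist: "distinct [o', x1, x2, z, x4, x5]"
    and cyc: "in_cyclic_order (map cis [x1, x2, z, x4, x5, \<alpha>, o'])"
    and eq: "D z x1 = D z x5" "D z x2 = D z x4"
  shows "D o' x1 * D o' x5 < D o' x2 * D o' x4"
proof -
  have rem: "f (cis y) \<omega> = 1" if "y \<in> {o', x1, x2, z, x4, x5}" for y
    using f_remote[of "cis y"] cis_neq[of y \<alpha>] x that by force
  have pos: "0 < D y y'" if "y \<in> {o', x1, x2, z, x4, x5}" "y' \<in> {o', x1, x2, z, x4, x5}" "y \<noteq> y'" for y y'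
    using f_pos[of "cis y" "cis y'"] cis_neq[of y y'] x that by force
  have "z \<noteq> x1" "z \<noteq> x2" "o' \<noteq> x4" "o' \<noteq> x1"
    using dist by auto
  then have nz: "D z x1 > 0" "D z x2 > 0" "D o' x4 > 0" "D o' x1 > 0"
    using pos by simp_all
  have "harmonic_tuple d (cis x1) (cis z) (cis x5) \<omega>"
    using rem nz eq f_sym[of "cis x1" "cis z"] unfolding harmonic_tuple_def cr2_def by simp
  moreover have "harmonic_tuple d (cis x2) (cis z) (cis x4) \<omega>"
    using rem nz eq f_sym[of "cis x2" "cis z"] unfolding harmonic_tuple_def cr2_def by simp
  ultimately have "cr1 d (cis x4) (cis x5) \<omega> (cis o') < cr1 d (cis x1) (cis x2) \<omega> (cis o')"
    using increment d_in cyc unfolding increment_axiom_def by simp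
  then have "D o' x5 / D o' x4 < D o' x2 / D o' x1"
    using rem f_sym[of "cis o'"] unfolding cr1_def by simp
  then show ?thesis
    using nz by (simp add: field_simps)
qed

sublocale chart: punctured_line \<alpha> "\<alpha> + 2 * pi" D
proof
  show "D s t = D t s" for s t by (simp add: f_sym)
  show "D s s = 0" for s by (simp add: f_refl)
  show "0 < D s t" if "\<alpha> < s" "s < \<alpha> + 2 * pi" "\<alpha> < t" "t < \<alpha> + 2 * pi" "s \<noteq> t" for s t
    using that by (intro f_pos cis_neq) auto
  show "continuous_on {\<alpha><..<\<alpha> + 2 * pi} (D s)" if "\<alpha> < s" "s < \<alpha> + 2 * pi" for s
    using D_continuous that .
  show "D s t * D u v < D s u * D t v \<and> D s v * D t u < D s u * D t v"
    if "\<alpha> < s" "s < t" "t < u" "u < v" "v < \<alpha> + 2 * pi" for s t u v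
    using cyclic_products[of s t u v] that by simp
  show "D s t < D s u \<and> D t u < D s u" if "\<alpha> < s" "s < t" "t < u" "u < \<alpha> + 2 * pi" for s t u
  proof -
    have "D \<alpha> y = 1" if "\<alpha> < y" "y < \<alpha> + 2 * pi" for y
      using f_remote[of "cis y"] f_sym[of \<omega> "cis y"] cis_neq[of y \<alpha>] that by simp
    then show ?thesis using cyclic_products[of \<alpha> s t u] that by simp
  qed
next
  fix o' x1 x2 z x4 x5
  assume *: "\<alpha> < o'" "o' < x1" "x1 < x2" "x2 < z" "z < x4" "x4 < x5" "x5 < \<alpha> + 2 * pi"
    "D z x1 = D z x5" "D z x2 = D z x4"
  have "in_cyclic_order (map cis [x1, x2, z, x4, x5, \<alpha>, o'])"
    unfolding in_cyclic_order_def counterclockwise_def using *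
    by (intro disjI1 exI[of _ "[x1, x2, z, x4, x5, \<alpha> + 2 * pi, o' + 2 * pi]"]) (auto simp: cis_turn)
  then show "D o' x1 * D o' x5 < D o' x2 * D o' x4"
    using * by (intro increment_remote) auto
next
  fix o' x1 x2 z x4 x5
  assume *: "\<alpha> < x1" "x1 < x2" "x2 < z" "z < x4" "x4 < x5" "x5 < o'" "o' < \<alpha> + 2 * pi"
    "D z x1 = D z x5" "D z x2 = D z x4"
  have "in_cyclic_order (map cis [x5, x4, z, x2, x1, \<alpha>, o'])"
    unfolding in_cyclic_order_def counterclockwise_def using *
    by (intro disjI2 exI[of _ "[o', \<alpha> + 2 * pi, x1 + 2 * pi, x2 + 2 * pi, z + 2 * pi, x4 + 2 * pi, x5 + 2 * pi]"]) (auto simp: cis_turn)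
  then have "D o' x5 * D o' x1 < D o' x4 * D o' x2"
    using * by (intro increment_remote[of o' x5 x4 z x2 x1]) auto
  then show "D o' x1 * D o' x5 < D o' x2 * D o' x4"
    by (simp add: mult.commute)
qed

section \<open>The height of a harmonic pair\<close>

text \<open>The number at the end \<open>e\<close> with opposite end \<open>e'\<close> is \<open>|ee'| |en| / |e'n|\<close>. If \<open>e'\<close> or \<open>n\<close> is \<open>\<omega>\<close>, the
  infinite factors cancel as usual. At \<open>e = \<omega>\<close> there are two infinite factors in the
  numerator and none in the denominator, so this end does not compete for the minimum.\<close>

definition height :: "axis_pair \<Rightarrow> real" where
  "height q = Min {f e e' * f e n / f e' n | e e' n. e \<noteq> \<omega> \<and>
     ({e, e'} = fst q \<and> n \<in> snd q \<or> {e, e'} = snd q \<and> n \<in> fst q)}"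

lemma height_swap: "height (a, b) = height (b, a)"
  unfolding height_def fst_conv snd_conv by (rule arg_cong[of _ _ Min], rule Collect_cong) blast

lemma height_eqI:
  assumes attained: "\<exists>e e' n. h = f e e' * f e n / f e' n \<and> e \<noteq> \<omega> \<and>
      ({e, e'} = {p, q} \<and> n \<in> {r, s} \<or> {e, e'} = {r, s} \<and> n \<in> {p, q})"
    and least: "\<And>e e' n. e \<noteq> \<omega> \<Longrightarrow> (e, e') \<in> {(p, q), (q, p)} \<and> n \<in> {r, s} \<or>
      (e, e') \<in> {(r, s), (s, r)} \<and> n \<in> {p, q} \<Longrightarrow> h \<le> f e e' * f e n / f e' n"
  shows "height ({p, q}, {r, s}) = h"
  unfolding height_def
proof (rule Min_eqI)
  let ?S = "{f e e' * f e n / f e' n | e e' n. e \<noteq> \<omega> \<and>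
     ({e, e'} = fst ({p, q}, {r, s}) \<and> n \<in> snd ({p, q}, {r, s}) \<or>
      {e, e'} = snd ({p, q}, {r, s}) \<and> n \<in> fst ({p, q}, {r, s}))}"
  have "?S \<subseteq> (\<lambda>(e, e', n). f e e' * f e n / f e' n) ` ({p, q, r, s} \<times> {p, q, r, s} \<times> {p, q, r, s})"
  proof
    fix y assume "y \<in> ?S"
    then obtain e e' n where y: "y = f e e' * f e n / f e' n"
       "{e, e'} = {p, q} \<and> n \<in> {r, s} \<or> {e, e'} = {r, s} \<and> n \<in> {p, q}"
      by auto
    then have "{e, e', n} \<subseteq> {p, q, r, s}" by blast
    then show "y \<in> (\<lambda>(e, e', n). f e e' * f e n / f e' n) ` ({p, q, r, s} \<times> {p, q, r, s} \<times> {p, q, r, s})"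
      using y(1) by (intro image_eqI[of _ _ "(e, e', n)"] SigmaI) auto
  qed
  then show "finite ?S" by (rule finite_subset) simp
  show "h \<le> y" if mem: "y \<in> ?S" for y
  proof -
    obtain e e' n where "y = f e e' * f e n / f e' n" "e \<noteq> \<omega>"
       "{e, e'} = {p, q} \<and> n \<in> {r, s} \<or> {e, e'} = {r, s} \<and> n \<in> {p, q}"
      using mem by auto
    moreover from this have "(e, e') \<in> {(p, q), (q, p)} \<and> n \<in> {r, s} \<or>
      (e, e') \<in> {(r, s), (s, r)} \<and> n \<in> {p, q}" by (auto simp: doubleton_eq_iff)
    ultimately show ?thesis using least by blast
  qed
  show "h \<in> ?S" using attained by auto
qed

text \<open>For the positions \<open>p < r < q < s\<close> the two inequalities assumed hold, and the minimum is attained at one of the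
  middle ends \<open>q\<close> and \<open>r\<close>. Exchanging \<open>p\<close> with \<open>q\<close> covers the mirror images.\<close>

lemma height_finite:
  assumes S1: "p \<in> S1" "q \<in> S1" "r \<in> S1" "s \<in> S1" and dist: "distinct [p, q, r, s]"
    and fin: "p \<noteq> \<omega>" "q \<noteq> \<omega>" "r \<noteq> \<omega>" "s \<noteq> \<omega>"
    and harm: "f p r * f q s = f p s * f q r"
    and le: "f q r \<le> f p r" "f p r \<le> f p s"
  shows "height ({p, q}, {r, s}) = min (f p q) (f r s * f p r / f q s) / (f p r / f q r)"
proof (rule height_eqI)
  have pos: "0 < f p q" "0 < f r s" "0 < f p r" "0 < f p s" "0 < f q r" "0 < f q s"
    using assms by (auto intro!: f_pos)
  define C L u where "C = f p q" and "L = f r s" and "u = f p r / f q r"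
  have u: "f p r = u * f q r" "f p s = u * f q s" "1 \<le> u"
    using pos harm le by (auto simp: u_def field_simps)
  have CL: "0 < C" "0 < L" "0 < u" using pos u by (auto simp: C_def L_def)
  have le': "f q r \<le> f q s"
    using le(2) u CL by simp
  have A: "f r s * f p r / f q s / u = L * (f q r / f q s)"
    using u CL pos by (simp add: L_def)
  have h: "min (f p q) (f r s * f p r / f q s) / (f p r / f q r) = min (C / u) (L * (f q r / f q s))"
    using A CL unfolding C_def[symmetric] u_def[symmetric]
    by (simp add: min_divide_distrib_right)
  have sym': "f q p = f p q" "f r p = f p r" "f r q = f q r" "f s p = f p s" "f s q = f q s" "f s r = f r s"
    using f_sym[OF S1(2,1)] f_sym[OF S1(3,1)] f_sym[OF S1(3,2)] f_sym[OF S1(4,1)] f_sym[OF S1(4,2)]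
      f_sym[OF S1(4,3)] .
  have vals: "f p r / f q r = u" "f p s / f q s = u" "f q r / f p r = 1 / u" "f q s / f p s = 1 / u"
    "f p r / f p s = f q r / f q s" "f p s / f p r = f q s / f q r"
    using u CL pos by auto
  have bounds: "C / u \<le> C * u" "L * (f q r / f q s) \<le> L * (f q s / f q r)"
  proof -
    have "C / u \<le> C" "C \<le> C * u"
      using CL u by (auto simp: divide_le_eq mult_le_cancel_left1 mult_le_cancel_right1)
    then show "C / u \<le> C * u" by simp
    have "f q r / f q s \<le> 1" "1 \<le> f q s / f q r" using le' pos by auto
    then have "f q r / f q s \<le> f q s / f q r" by linarith
    then show "L * (f q r / f q s) \<le> L * (f q s / f q r)" using CL by (intro mult_left_mono) auto
  qed
  have products: "f p q * f p r / f q r = C * u" "f p q * f p s / f q s = C * u"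
    "f q p * f q r / f p r = C / u" "f q p * f q s / f p s = C / u"
    "f r s * f r p / f s p = L * (f q r / f q s)" "f r s * f r q / f s q = L * (f q r / f q s)"
    "f s r * f s p / f r p = L * (f q s / f q r)" "f s r * f s q / f r q = L * (f q s / f q r)"
    unfolding sym' times_divide_eq_right[symmetric] vals by (simp_all add: C_def L_def)
  have "(C / u = f q p * f q r / f p r \<and> q \<noteq> \<omega> \<and> {q, p} = {p, q} \<and> r \<in> {r, s})"
      "(L * (f q r / f q s) = f r s * f r q / f s q \<and> r \<noteq> \<omega> \<and> {r, s} = {r, s} \<and> q \<in> {p, q})"
    using fin products by auto
  then show "\<exists>e e' n. min (f p q) (f r s * f p r / f q s) / (f p r / f q r) = f e e' * f e n / f e' n \<and> e \<noteq> \<omega> \<and>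
      ({e, e'} = {p, q} \<and> n \<in> {r, s} \<or> {e, e'} = {r, s} \<and> n \<in> {p, q})"
    unfolding h by (cases "C / u \<le> L * (f q r / f q s)") (simp only: min_absorb1 min_absorb2 linear, blast)+
  fix e e' n
  assume "(e, e') \<in> {(p, q), (q, p)} \<and> n \<in> {r, s} \<or> (e, e') \<in> {(r, s), (s, r)} \<and> n \<in> {p, q}"
  then have "f e e' * f e n / f e' n \<in> {C * u, C / u, L * (f q r / f q s), L * (f q s / f q r)}"
    using products by auto
  then show "min (f p q) (f r s * f p r / f q s) / (f p r / f q r) \<le> f e e' * f e n / f e' n"
    unfolding h using bounds by auto
qed

lemma height_vertical:
  assumes S1: "p \<in> S1" "q \<in> S1" "r \<in> S1" and dist: "distinct [p, q, r, \<omega>]"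
    and eq: "f p r = f q r" and le: "f p r \<le> f p q"
  shows "height ({p, q}, {r, \<omega>}) = f p r"
proof (rule height_eqI)
  have pos: "0 < f p q" "0 < f p r" using assms by (auto intro!: f_pos)
  have sym: "f q p = f p q" "f r p = f p r" "f r q = f p r" "f q r = f p r"
    using f_sym[OF S1(2,1)] f_sym[OF S1(3,1)] f_sym[OF S1(3,2)] eq by simp_all
  have rem: "f p \<omega> = 1" "f q \<omega> = 1" "f r \<omega> = 1"
    using dist f_remote[OF S1(1)] f_remote[OF S1(2)] f_remote[OF S1(3)] by auto
  then have rem': "f \<omega> p = 1" "f \<omega> q = 1" "f \<omega> r = 1"
    using f_sym[OF cis_S1 S1(1)] f_sym[OF cis_S1 S1(2)] f_sym[OF cis_S1 S1(3)] by simp_all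
  show "\<exists>e e' n. f p r = f e e' * f e n / f e' n \<and> e \<noteq> \<omega> \<and>
      ({e, e'} = {p, q} \<and> n \<in> {r, \<omega>} \<or> {e, e'} = {r, \<omega>} \<and> n \<in> {p, q})"
    using dist pos by (intro exI[of _ r] exI[of _ \<omega>] exI[of _ p]) (auto simp: sym rem rem')
  fix e e' n
  assume "e \<noteq> \<omega>" "(e, e') \<in> {(p, q), (q, p)} \<and> n \<in> {r, \<omega>} \<or> (e, e') \<in> {(r, \<omega>), (\<omega>, r)} \<and> n \<in> {p, q}"
  then show "f p r \<le> f e e' * f e n / f e' n"
    using pos le by (auto simp: sym rem rem')
qed


lemma finite_point:
  assumes "x \<in> S1" "x \<noteq> \<omega>"
  obtains t where "\<alpha> < t" "t < \<alpha> + 2 * pi" "x = cis t"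
proof -
  obtain t where t: "\<alpha> \<le> t" "t < \<alpha> + 2 * pi" "x = cis t"
    using angle_above[OF assms(1)] by blast
  then show thesis using assms(2) that[of t] by (cases "t = \<alpha>") auto
qed

lemma cis_finite: "\<lbrakk>\<alpha> < s; s < \<alpha> + 2 * pi\<rbrakk> \<Longrightarrow> cis s \<noteq> \<omega>"
  using cis_neq[of s \<alpha>] by auto

lemma crossing_remote:
  assumes "\<alpha> < p" "p < q" "q < \<alpha> + 2 * pi" "\<alpha> < r" "r < \<alpha> + 2 * pi" "r \<noteq> p" "r \<noteq> q"
    and eq: "D p r = D q r"
  shows "p < r \<and> r < q"
proof (rule ccontr)
  assume "\<not> ?thesis"
  then consider "r < p" | "q < r" using assms by linarith
  then show False
  proof cases
    case 1 then show False using chart.D_three[of r p q] assms by (simp add: f_sym[of "cis r"])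
  next
    case 2 then show False using chart.D_three[of p q r] assms by simp
  qed
qed

text \<open>The axes of a harmonic pair separate each other: in any other position Axiom (M) makes the two equal
  products different. The lemma above is the case of an end at \<open>\<omega>\<close>.\<close>

lemma crossing_finite:
  assumes "\<alpha> < p" "p < q" "q < \<alpha> + 2 * pi" "\<alpha> < r" "r < s" "s < \<alpha> + 2 * pi"
    and ne: "r \<noteq> p" "r \<noteq> q" "s \<noteq> p" "s \<noteq> q"
    and eq: "D p r * D q s = D p s * D q r"
  shows "r < p \<and> p < s \<and> s < q \<or> p < r \<and> r < q \<and> q < s"
proof (rule ccontr)
  assume "\<not> ?thesis"
  then consider "s < p" | "r < p" "q < s" | "p < r" "s < q" | "q < r" using assms by linarith
  then show False
  proof cases
    case 1 then show False using chart.D_four[of r s p q] assms chart.D_sym by (simp add: chart.D_sym mult.commute)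
  next
    case 2 then show False using chart.D_four[of r p q s] assms by (simp add: chart.D_sym mult.commute)
  next
    case 3 then show False using chart.D_four[of p r s q] assms by (simp add: chart.D_sym mult.commute)
  next
    case 4 then show False using chart.D_four[of p q r s] assms by (simp add: chart.D_sym mult.commute)
  qed
qed

lemma height_chart:
  assumes pq: "\<alpha> < p" "p < q" "q < \<alpha> + 2 * pi" and Harm: "({cis p, cis q}, b) \<in> Harm M"
  obtains r x where "p < r" "r < q" "b = {cis r, x}"
    "chart.height_left p q r (height ({cis p, cis q}, b)) \<or> chart.height_mid p q r (height ({cis p, cis q}, b)) \<or>
     chart.height_right p q r (height ({cis p, cis q}, b))"
proof -
  obtain z u where b: "b = {z, u}"
    using Harm_cases[OF Harm] by (metis prod.inject)
  have rem: "f (cis p) \<omega> = 1" "f (cis q) \<omega> = 1"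
    using f_remote cis_finite pq by auto
  note found = that
  have mid: thesis if H: "({cis p, cis q}, {z, \<omega>}) \<in> Harm M" and bz: "b = {z, \<omega>}" for z
  proof -
    note h = Harm_labelled[OF moebius d_in H]
    obtain r where r: "\<alpha> < r" "r < \<alpha> + 2 * pi" "z = cis r"
      using finite_point[of z] h by auto
    have eq: "D p r = D q r" using h(3) rem r by simp
    have pr: "p < r \<and> r < q"
      using crossing_remote[of p q r] pq r h(2) eq by auto
    then have "height ({cis p, cis q}, {cis r, \<omega>}) = D p r"
      using h(2) r eq chart.D_three[of p r q] pq by (intro height_vertical) auto
    then show thesis
      using found[of r \<omega>] pr eq bz r by (simp add: chart.height_mid_def)
  qed
  have fin: thesis if H: "({cis p, cis q}, {cis r, cis s}) \<in> Harm M" and bz: "b = {cis r, cis s}"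
    and rs: "\<alpha> < r" "r < s" "s < \<alpha> + 2 * pi" for r s
  proof -
    note h = Harm_labelled[OF moebius d_in H]
    have ne: "r \<noteq> p" "r \<noteq> q" "s \<noteq> p" "s \<noteq> q" using h(2) by auto
    have eq: "D p r * D q s = D p s * D q r" using h(3) .
    consider "r < p" "p < s" "s < q" | "p < r" "r < q" "q < s"
      using crossing_finite[of p q r s] pq rs ne eq by blast
    then show thesis
    proof cases
      case 1
      have eq': "D p s * D q r = D p r * D q s" using eq by simp
      have less: "D p r < D q r" using chart.D_three[of r p q] 1 pq rs by (simp add: chart.D_sym)
      have pos: "0 < D p r" "0 < D q r" "0 < D q s" "0 < D p s"
        using pq rs ne by (auto intro!: chart.D_pos)
      have "D p s * D q r < D q s * D q r"
        using eq' less pos by simp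
      then have less': "D p s < D q s" using pos by simp
      have "height ({cis q, cis p}, {cis s, cis r}) =
          min (D q p) (D s r * D q s / D p r) / (D q s / D p s)"
        using h(2) pq rs eq less' chart.D_three[of s q r] chart.D_three[of r s q] 1
        by (intro height_finite) (auto simp: cis_finite chart.D_sym mult.commute)
      then have "height ({cis p, cis q}, b) = min (D p q) (D s r * D q s / D p r) * chart.level p q s"
        unfolding chart.level_def bz by (simp add: insert_commute chart.D_sym[of q p])
      then have "chart.height_left p q s (height ({cis p, cis q}, b))"
        unfolding chart.height_left_def using 1 rs eq' by auto
      then show thesis using found[of s "cis r"] 1 bz by (simp add: insert_commute)
    next
      case 2
      have u: "1 < chart.level p q r" using chart.level_right(2)[of p r q s] 2 pq rs eq by simp
      have "0 < D q r" using pq 2 by (auto intro!: chart.D_pos)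
      then have less: "D q r < D p r" using u by (simp add: chart.level_def)
      have "height ({cis p, cis q}, {cis r, cis s}) =
          min (D p q) (D r s * D p r / D q s) / (D p r / D q r)"
        using h(2) pq rs eq less chart.D_three[of p r s] 2
        by (intro height_finite) (auto simp: cis_finite)
      then have "chart.height_right p q r (height ({cis p, cis q}, b))"
        unfolding chart.height_right_def chart.level_def bz using 2 rs eq by auto
      then show thesis using found[of r "cis s"] 2 bz by simp
    qed
  qed
  note h = Harm_labelled[OF moebius d_in Harm[unfolded b]]
  show thesis
  proof (cases "z = \<omega> \<or> u = \<omega>")
    case True
    then show thesis using mid[of z] mid[of u] Harm b by (auto simp: insert_commute)
  next
    case False
    obtain r s where rs: "\<alpha> < r" "r < \<alpha> + 2 * pi" "z = cis r" "\<alpha> < s" "s < \<alpha> + 2 * pi" "u = cis s"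
      using finite_point[of z] finite_point[of u] h False by metis
    moreover have "r \<noteq> s" using rs h(2) by auto
    ultimately show thesis
      using fin[of r s] fin[of s r] Harm b by (cases "r < s") (auto simp: insert_commute)
  qed
qed

text \<open>The height on the line with axis \<open>{x, \<omega>}\<close> comes from \<open>height_vertical\<close> with the two axes exchanged: \<open>x\<close> is
  the midpoint of \<open>z\<close> and \<open>u\<close>.\<close>

lemma height_vertical_axis:
  assumes H: "({x, \<omega>}, {z, u}) \<in> Harm M"
  shows "height ({x, \<omega>}, {z, u}) = f x z"
proof -
  note h = Harm_labelled[OF moebius d_in H]
  have fin: "x \<noteq> \<omega>" "z \<noteq> \<omega>" "u \<noteq> \<omega>" and S1: "x \<in> S1" "z \<in> S1" "u \<in> S1" using h(1,2) by auto
  have rem: "f \<omega> z = 1" "f \<omega> u = 1"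
    using f_remote[of z] f_remote[of u] f_sym[of \<omega> z] f_sym[of \<omega> u] fin S1 by auto
  have sym: "f x z = f z x" "f x u = f u x" using f_sym S1 by auto
  have eq: "f z x = f u x" using h(3) rem sym by simp
  have le: "f z x \<le> f z u"
  proof -
    obtain p r s where a: "\<alpha> < p" "p < \<alpha> + 2 * pi" "x = cis p"
      "\<alpha> < r" "r < \<alpha> + 2 * pi" "z = cis r" "\<alpha> < s" "s < \<alpha> + 2 * pi" "u = cis s"
      using finite_point S1 fin by metis
    have "r \<noteq> s" "r \<noteq> p" "p \<noteq> s" using a h(2) by auto
    then consider "r < s" | "s < r" by linarith
    then show ?thesis
    proof cases
      case 1
      then have "r < p \<and> p < s" using crossing_remote[of r s p] a eq \<open>r \<noteq> p\<close> \<open>p \<noteq> s\<close> by simp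
      then show ?thesis using chart.D_three[of r p s] a by simp
    next
      case 2
      then have "s < p \<and> p < r" using crossing_remote[of s r p] a eq \<open>r \<noteq> p\<close> \<open>p \<noteq> s\<close> by simp
      then show ?thesis using chart.D_three[of s p r] a eq by (simp add: chart.D_sym)
    qed
  qed
  have "height ({z, u}, {x, \<omega>}) = f z x"
    using S1 h(2) eq le by (intro height_vertical) auto
  then show ?thesis using height_swap sym by simp
qed

lemma axis_dist_vertical:
  assumes H: "({x, \<omega>}, b) \<in> Harm M" "({x, \<omega>}, b') \<in> Harm M"
  shows "axis_dist M {x, \<omega>} b b' = \<bar>ln (height ({x, \<omega>}, b)) - ln (height ({x, \<omega>}, b'))\<bar>"
proof -
  obtain z u z' u' where b: "b = {z, u}" "b' = {z', u'}"
    using Harm_cases[OF H(1)] Harm_cases[OF H(2)] by (metis prod.inject)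
  note h = Harm_labelled[OF moebius d_in H(1)[unfolded b]] Harm_labelled[OF moebius d_in H(2)[unfolded b]]
  have "f \<omega> z = 1" "f \<omega> z' = 1"
    using f_remote[of z] f_remote[of z'] f_sym[of \<omega> z] f_sym[of \<omega> z'] h by auto
  then show ?thesis
    using axis_dist_eq[OF moebius d_in H[unfolded b]] H by (simp add: b height_vertical_axis)
qed

lemma height_lipschitz:
  assumes H: "(a, b) \<in> Harm M" "(a, b') \<in> Harm M"
  shows "\<bar>ln (height (a, b)) - ln (height (a, b'))\<bar> \<le> axis_dist M a b b'"
proof -
  obtain x y where a: "a = {x, y}"
    using Harm_cases[OF H(1)] by (metis prod.inject)
  have S1: "x \<in> S1" "y \<in> S1" "x \<noteq> y"
    using Harm_axis[OF moebius H(1)[unfolded a]] .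
  show ?thesis
  proof (cases "x = \<omega> \<or> y = \<omega>")
    case True
    then obtain v where "a = {v, \<omega>}" using a by (auto simp: insert_commute)
    then show ?thesis using axis_dist_vertical H by simp
  next
    case False
    obtain p q where pq: "\<alpha> < p" "p < q" "q < \<alpha> + 2 * pi" "a = {cis p, cis q}"
    proof -
      obtain s t where "\<alpha> < s" "s < \<alpha> + 2 * pi" "x = cis s" "\<alpha> < t" "t < \<alpha> + 2 * pi" "y = cis t"
        using finite_point S1 False by metis
      then show thesis
        using that[of s t] that[of t s] S1(3) a by (cases "s < t") (auto simp: insert_commute not_less order_less_le)
    qed
    obtain r v where r: "p < r" "r < q" "b = {cis r, v}"
      "chart.height_left p q r (height (a, b)) \<or> chart.height_mid p q r (height (a, b)) \<or>
       chart.height_right p q r (height (a, b))"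
      using height_chart[OF pq(1-3)] H(1) unfolding pq(4) by blast
    obtain r' v' where r': "p < r'" "r' < q" "b' = {cis r', v'}"
      "chart.height_left p q r' (height (a, b')) \<or> chart.height_mid p q r' (height (a, b')) \<or>
       chart.height_right p q r' (height (a, b'))"
      using height_chart[OF pq(1-3)] H(2) unfolding pq(4) by blast
    have "\<bar>ln (height (a, b)) - ln (height (a, b'))\<bar> \<le>
        \<bar>ln (chart.level p q r) - ln (chart.level p q r')\<bar>"
      using chart.height_line_lipschitz[OF pq(1) r(1,2) r'(1,2) pq(3) r(4) r'(4)] .
    also have "\<dots> = axis_dist M a b b'"
      using axis_dist_eq[OF moebius d_in, of "cis p" "cis q" "cis r" v "cis r'" v'] H
      by (simp add: pq(4) r(3) r'(3) chart.level_def)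
    finally show ?thesis .
  qed
qed

lemma side_lipschitz:
  assumes "left_side M q q' \<or> right_side M q q'"
  shows "\<bar>ln (height q) - ln (height q')\<bar> \<le> line_dist M q q'"
proof -
  obtain a b a' b' where q: "q = (a, b)" "q' = (a', b')" by (cases q, cases q')
  show ?thesis
    using assms
  proof
    assume "left_side M q q'"
    then show ?thesis
      using height_lipschitz[of a b b'] by (auto simp: left_side_def left_line_def q line_dist_def)
  next
    assume r: "right_side M q q'"
    then have "b' = b" "a \<noteq> a'" "(a, b) \<in> Harm M" "(a', b) \<in> Harm M"
      by (auto simp: right_side_def right_line_def q)
    then show ?thesis
      using height_lipschitz[of b a a'] Harm_swap[OF moebius] height_swap[of b]
      by (simp add: q line_dist_def)
  qed
qed

lemma zz_path_lipschitz:
  assumes "zz_path M q q' qs"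
  shows "\<bar>ln (height q) - ln (height q')\<bar> \<le> zz_length M qs"
proof -
  have sides: "\<bar>ln (height (qs ! i)) - ln (height (qs ! Suc i))\<bar> \<le> line_dist M (qs ! i) (qs ! Suc i)"
    if "i < length qs - 1" for i
    using assms that side_lipschitz by (auto simp: zz_path_def)
  have "ln (height (qs ! 0)) - ln (height (qs ! (length qs - 1))) =
      (\<Sum>i<length qs - 1. ln (height (qs ! i)) - ln (height (qs ! Suc i)))"
    by (rule sum_lessThan_telescope'[symmetric])
  then have "\<bar>ln (height (qs ! 0)) - ln (height (qs ! (length qs - 1)))\<bar> \<le> zz_length M qs"
    unfolding zz_length_def using sides by (auto intro!: order_trans[OF sum_abs] sum_mono)
  moreover have "qs ! 0 = q" "qs ! (length qs - 1) = q'"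
    using assms hd_conv_nth[of qs] last_conv_nth[of qs] by (auto simp: zz_path_def)
  ultimately show ?thesis by simp
qed

end

text \<open>The end \<open>y\<close> of the common axis is made infinitely remote; then the distance is the difference of two
  heights.\<close>

lemma axis_dist_le_zz_length:
  assumes "moebius_structure S1 M" "monotone_moebius M" "increment_axiom M"
    and H: "(a, b) \<in> Harm M" "(a, b') \<in> Harm M"
    and q: "q = (a, b) \<and> q' = (a, b') \<or> q = (b, a) \<and> q' = (b', a)"
    and path: "zz_path M q q' qs"
  shows "axis_dist M a b b' \<le> zz_length M qs"
proof -
  obtain d0 where d0: "d0 \<in> M" using moebius_structure_nonempty[OF assms(1)] .
  obtain x y where a: "a = {x, y}" using Harm_cases[OF H(1)] by (metis prod.inject)
  have y: "y \<in> S1"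
    using Harm_axis(2)[OF assms(1) H(1)[unfolded a]] .
  obtain \<alpha> where \<alpha>: "y = cis \<alpha>" using angle_above[OF y] by blast
  have inf: "infinite S1"
  proof
    assume "finite S1"
    then have "finite (cis ` {0<..<1})" by (rule finite_subset[rotated]) auto
    moreover have "inj_on cis {0<..<1}"
      using pi_gt3 by (intro inj_onI cis_inj_period) auto
    ultimately show False using finite_imageD infinite_Ioo[of 0 "1::real"] by fastforce
  qed
  define d where "d = metric_inversion d0 y"
  have "d \<in> M" unfolding d_def
    using moebius_structure_closed[OF assms(1) d0 equivalent_metric_inversion]
      moebius_structure_semimetric[OF assms(1) d0] y inf by blast
  then interpret based_moebius M d \<alpha>
    using assms(1-3) remote_metric_inversion[OF y, of d0] by unfold_locales (auto simp: d_def \<alpha>)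
  have "axis_dist M a b b' = \<bar>ln (height (a, b)) - ln (height (a, b'))\<bar>"
    using axis_dist_vertical[of x b b'] H by (simp add: a \<alpha>)
  also have "\<dots> = \<bar>ln (height q) - ln (height q')\<bar>"
    using q height_swap by auto
  also have "\<dots> \<le> zz_length M qs"
    using zz_path_lipschitz[OF path] .
  finally show ?thesis .
qed

lemma zz_dist_eqI:
  assumes path: "zz_path M q q' qs" "zz_length M qs = r"
    and least: "\<And>qs. zz_path M q q' qs \<Longrightarrow> r \<le> zz_length M qs"
  shows "zz_dist M q q' = ereal r"
  unfolding zz_dist_def
proof (rule antisym)
  show "(INF qs\<in>{qs. zz_path M q q' qs}. ereal (zz_length M qs)) \<le> ereal r"
    using path by (intro INF_lower2[of qs]) auto
  show "ereal r \<le> (INF qs\<in>{qs. zz_path M q q' qs}. ereal (zz_length M qs))"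
    using least by (intro INF_greatest) auto
qed

lemma axis_dist_self:
  assumes M: "moebius_structure S1 M" and H: "(a, b) \<in> Harm M"
  shows "axis_dist M a b b = 0"
proof -
  obtain d where d: "d \<in> M" using moebius_structure_nonempty[OF M] .
  obtain x y z u where "a = {x, y}" "b = {z, u}" using Harm_cases[OF H] by (metis prod.inject)
  then show ?thesis using axis_dist_eq[OF M d, of x y z u z u] H by simp
qed

lemma line_geodesic:
  assumes M: "moebius_structure S1 M" "monotone_moebius M" "increment_axiom M"
    and H: "(a, b) \<in> Harm M" "(a, b') \<in> Harm M"
    and aY: "a \<in> aY"
    and q: "q = (a, b) \<and> q' = (a, b') \<or> q = (b, a) \<and> q' = (b', a)"
  shows "zz_dist M q q' = ereal (line_dist M q q')"
proof -
  have in_Harm: "q \<in> Harm M" "q' \<in> Harm M"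
    using q H Harm_swap[OF M(1)] by auto
  have dist: "line_dist M q q' = axis_dist M a b b'"
    using q axis_dist_self[OF M(1) H(1)] axis_dist_self[OF M(1) Harm_swap[OF M(1) H(1)]]
    by (auto simp: line_dist_def)
  have least: "line_dist M q q' \<le> zz_length M qs" if "zz_path M q q' qs" for qs
    using axis_dist_le_zz_length[OF M H q that] dist by simp
  show ?thesis
  proof (cases "q = q'")
    case True
    then have "line_dist M q q' = 0"
      using q axis_dist_self[OF M(1) H(1)] dist by auto
    moreover have "zz_path M q q' [q]" "zz_length M [q] = 0"
      using True in_Harm by (simp_all add: zz_path_def zz_length_def)
    ultimately show ?thesis using least by (intro zz_dist_eqI[of M q q' "[q]"]) auto
  next
    case False
    then have "left_side M q q' \<or> right_side M q q'"
      using q in_Harm aY by (auto simp: left_side_def right_side_def left_line_def right_line_def)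
    then have "zz_path M q q' [q, q']"
      using in_Harm by (auto simp: zz_path_def nth_Cons')
    moreover have "zz_length M [q, q'] = line_dist M q q'"
      by (simp add: zz_length_def)
    ultimately show ?thesis using least by (intro zz_dist_eqI[of M q q' "[q, q']"]) auto
  qed
qed

theorem theorem1p1:
  fixes M :: "complex semimetric set"
  assumes "moebius_structure S1 M"
    and "monotone_moebius M"
    and "increment_axiom M"
  shows "\<forall>h\<in>lines M. \<forall>q\<in>h. \<forall>q'\<in>h. zz_dist M q q' = ereal (line_dist M q q')"
proof (intro ballI)
  fix h q q' assume h: "h \<in> lines M" and q: "q \<in> h" "q' \<in> h"
  from h obtain a where a: "a \<in> aY" "h = left_line M a \<or> h = right_line M a"
    by (auto simp: lines_def)
  obtain c b c' b' where cb: "q = (c, b)" "q' = (c', b')" by (cases q, cases q')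
  from a(2) show "zz_dist M q q' = ereal (line_dist M q q')"
  proof
    assume "h = left_line M a"
    then have "(a, b) \<in> Harm M" "(a, b') \<in> Harm M" "q = (a, b) \<and> q' = (a, b')"
      using q cb by (auto simp: left_line_def)
    then show ?thesis using line_geodesic[OF assms _ _ a(1)] by blast
  next
    assume "h = right_line M a"
    then have "(a, c) \<in> Harm M" "(a, c') \<in> Harm M" "q = (c, a) \<and> q' = (c', a)"
      using q cb Harm_swap[OF assms(1)] by (auto simp: right_line_def)
    then show ?thesis using line_geodesic[OF assms _ _ a(1)] by blast
  qed
qed

end
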